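(* Let $\sigma$ be an admissible finite product of Brun substitutions or an admissible finite product of Jacobi-Perron substitutions. Then the Rauzy fractal $\mathcal T_\sigma$ and its subtiles $\mathcal T_\sigma(1)$, $\mathcal T_\sigma(2)$, $\mathcal T_\sigma(3)$ are all connected.
   Context: Brun substitutions on $\{1,2,3\}$: $\sigma^{\mathsf{Br}}_1:1\mapsto1,2\mapsto2,3\mapsto32$; $\sigma^{\mathsf{Br}}_2:1\mapsto1,2\mapsto3,3\mapsto23$; $\sigma^{\mathsf{Br}}_3:1\mapsto2,2\mapsto3,3\mapsto13$. A product (composition) $\sigma^{\mathsf{Br}}_{i_1}\cdots\sigma^{\mathsf{Br}}_{i_n}$ is admissible if $i_k=3$ for some $k$. Jacobi-Perron substitutions: $\sigma^{\mathsf{JP}}_{a,b}:1\mapsto3,2\mapsto13^a,3\mapsto23^b$ for integers $a,b\ge0$. A product $\sigma^{\mathsf{JP}}_{a_1,b_1}\cdots\sigma^{\mathsf{JP}}_{a_n,b_n}$ is admissible if for every $1\le k\le n$: $0\le a_k\le b_k$, $b_k\ne0$, and $a_k=b_k$ implies $a_{k+1}\ne0$, where $a_{n+1}:=a_1$. Such admissible products are unimodular irreducible Pisot substitutions. For a substitution $\sigma$, $\mathbf P(w)=(|w|_1,|w|_2,|w|_3)$ and $\mathbf M_\sigma$ is the matrix with $i$th column $\mathbf P(\sigma(i))$; $\sigma$ is unimodular if $\det\mathbf M_\sigma=\pm1$ and irreducible Pisot if the characteristic polynomial of $\mathbf M_\sigma$ is the minimal polynomial of a Pisot number. For $\mathbf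 x\in\mathbb Z^3$, $i\in\{1,2,3\}$, the face $[\mathbf x,i]^\star$ is the unit square $\{\mathbf x+\lambda\mathbf e_j+\mu\mathbf e_k:\lambda,\mu\in[0,1]\}$, $\{i,j,k\}=\{1,2,3\}$; $U=[\mathbf 0,1]^\star\cup[\mathbf 0,2]^\star\cup[\mathbf 0,3]^\star$. The dual substitution of a unimodular $\sigma$ is $\mathbf E_1^\star(\sigma)([\mathbf x,i]^\star)=\bigcup_{(p,j,s):\,\sigma(j)=pis}[\mathbf M_\sigma^{-1}(\mathbf x+\mathbf P(s)),j]^\star$, extended to unions of faces by unions. Rauzy fractal. For a unimodular irreducible Pisot substitution $\sigma$, let $\pi_{\mathrm c}$ be the projection onto the contracting eigenplane of $\mathbf M_\sigma$ along its expanding eigendirection. The Rauzy fractal $\mathcal T_\sigma$ is the Hausdorff limit of $\mathbf M_\sigma^n\,\pi_{\mathrm c}(\mathbf E_1^\star(\sigma)^n(U))$, and the subtile $\mathcal T_\sigma(i)$ is the Hausdorff limit of $\mathbf M_\sigma^n\,\pi_{\mathrm c}(\mathbf E_1^\star(\sigma)^n([\mathbf 0,i]^\star))$, as $n\to\infty$. *)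

theory Defs
  imports "HOL-Analysis.Analysis"
begin

(* The alphabet {1,2,3} is the numeral type 3, in which the letter 3 coincides with 0.
   A substitution is given by the images of the letters. *)
type_synonym word = "3 list"
type_synonym subst = "3 \<Rightarrow> word"

definition subst_word :: "subst \<Rightarrow> word \<Rightarrow> word" where
  "subst_word \<sigma> w = concat (map \<sigma> w)"

definition subst_comp :: "subst \<Rightarrow> subst \<Rightarrow> subst" where
  "subst_comp \<sigma> \<tau> = (\<lambda>a. subst_word \<sigma> (\<tau> a))"

(* subst_prod [s1, ..., sn] is the composition s1 o ... o sn (sn is applied first). *)
definition subst_prod :: "subst list \<Rightarrow> subst" where
  "subst_prod \<sigma>s = foldr subst_comp \<sigma>s (\<lambda>a. [a])"


definition brun :: "3 \<Rightarrow> subst" where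
  "brun k =
    (if k = 1 then (\<lambda>a. if a = 1 then [1] else if a = 2 then [2] else [3, 2])
     else if k = 2 then (\<lambda>a. if a = 1 then [1] else if a = 2 then [3] else [2, 3])
     else (\<lambda>a. if a = 1 then [2] else if a = 2 then [3] else [1, 3]))"

definition admissible_brun :: "3 list \<Rightarrow> bool" where
  "admissible_brun ks \<longleftrightarrow> 3 \<in> set ks"

definition jacobi_perron :: "nat \<times> nat \<Rightarrow> subst" where
  "jacobi_perron = (\<lambda>(a, b) c.
     if c = 1 then [3] else if c = 2 then 1 # replicate a 3 else 2 # replicate b 3)"

(* The pairs (a_k, b_k) are indexed cyclically; the empty product (the identity) is excluded. *)
definition admissible_jacobi_perron :: "(nat \<times> nat) list \<Rightarrow> bool" where
  "admissible_jacobi_perron ps \<longleftrightarrow> ps \<noteq> [] \<and>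
     (\<forall>k < length ps.
        fst (ps ! k) \<le> snd (ps ! k) \<and> snd (ps ! k) \<noteq> 0 \<and>
        (fst (ps ! k) = snd (ps ! k) \<longrightarrow> fst (ps ! (Suc k mod length ps)) \<noteq> 0))"


definition abelianization :: "word \<Rightarrow> int^3" where
  "abelianization w = (\<chi> i. int (count_list w i))"

definition incidence_matrix :: "subst \<Rightarrow> int^3^3" where
  "incidence_matrix \<sigma> = (\<chi> r c. abelianization (\<sigma> c) $ r)"

(* A pair (x, i) encodes the face [x,i]*.  The faces contained in a union of faces are exactly
   the faces forming it, so a union of faces is encoded by the set of its faces. *)
type_synonym face = "(int^3) \<times> 3"

definition face_set :: "face \<Rightarrow> (real^3) set" where
  "face_set = (\<lambda>(x, i).
     {(\<chi> l. real_of_int (x $ l)) + s *\<^sub>R axis j 1 + t *\<^sub>R axis k 1 | s t j k.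
        s \<in> {0..1} \<and> t \<in> {0..1} \<and> {i, j, k} = UNIV})"

definition unit_faces :: "face set" where
  "unit_faces = {(0, 1), (0, 2), (0, 3)}"

(* For unimodular substitutions the incidence matrix is invertible over the integers. *)
definition E1_star :: "subst \<Rightarrow> face set \<Rightarrow> face set" where
  "E1_star \<sigma> F =
     {(matrix_inv (incidence_matrix \<sigma>) *v (x + abelianization s), j) | x i p j s.
        (x, i) \<in> F \<and> \<sigma> j = p @ [i] @ s}"


definition real_incidence_matrix :: "subst \<Rightarrow> real^3^3" where
  "real_incidence_matrix \<sigma> = map_matrix real_of_int (incidence_matrix \<sigma>)"

definition complex_incidence_matrix :: "subst \<Rightarrow> complex^3^3" where
  "complex_incidence_matrix \<sigma> = map_matrix complex_of_int (incidence_matrix \<sigma>)"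

(* The real points of the complex span of the eigenvectors with eigenvalue of modulus < 1.
   In the irreducible Pisot case the eigenvalues are simple and this is a plane. *)
definition contracting_plane :: "subst \<Rightarrow> (real^3) set" where
  "contracting_plane \<sigma> =
     {v. (\<chi> i. complex_of_real (v $ i)) \<in>
           vec.span {w. \<exists>z. cmod z < 1 \<and> complex_incidence_matrix \<sigma> *v w = z *s w}}"

definition expanding_line :: "subst \<Rightarrow> (real^3) set" where
  "expanding_line \<sigma> =
     span {v. \<exists>r. \<bar>r\<bar> > 1 \<and> real_incidence_matrix \<sigma> *v v = r *\<^sub>R v}"

(* Projection onto the contracting plane along the expanding line.  It is determined when the
   two are complementary, in particular for irreducible Pisot substitutions. *)
definition proj_contracting :: "subst \<Rightarrow> real^3 \<Rightarrow> real^3" where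
  "proj_contracting \<sigma> x = (THE y. y \<in> contracting_plane \<sigma> \<and> x - y \<in> expanding_line \<sigma>)"


(* Intended for nonempty bounded sets. *)
definition hausdorff_distance :: "'a::metric_space set \<Rightarrow> 'a set \<Rightarrow> real" where
  "hausdorff_distance A B = max (SUP a\<in>A. infdist a B) (SUP b\<in>B. infdist b A)"

definition is_hausdorff_limit :: "(nat \<Rightarrow> 'a::metric_space set) \<Rightarrow> 'a set \<Rightarrow> bool" where
  "is_hausdorff_limit A T \<longleftrightarrow>
     compact T \<and> T \<noteq> {} \<and> (\<lambda>n. hausdorff_distance (A n) T) \<longlonglongrightarrow> 0"

definition hausdorff_limit :: "(nat \<Rightarrow> 'a::metric_space set) \<Rightarrow> 'a set" where
  "hausdorff_limit A = (THE T. is_hausdorff_limit A T)"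

(* M^n (pi_c (E_1*^n (F))) for a union of faces F *)
definition rauzy_approx :: "subst \<Rightarrow> face set \<Rightarrow> nat \<Rightarrow> (real^3) set" where
  "rauzy_approx \<sigma> F n =
     (((*v) (real_incidence_matrix \<sigma>)) ^^ n) `
       (proj_contracting \<sigma> ` (\<Union>f \<in> (E1_star \<sigma> ^^ n) F. face_set f))"

(* The next two definitions are meaningful for unimodular irreducible Pisot substitutions. *)
definition rauzy_fractal :: "subst \<Rightarrow> (real^3) set" where
  "rauzy_fractal \<sigma> = hausdorff_limit (rauzy_approx \<sigma> unit_faces)"

definition rauzy_subtile :: "subst \<Rightarrow> 3 \<Rightarrow> (real^3) set" where
  "rauzy_subtile \<sigma> i = hausdorff_limit (rauzy_approx \<sigma> {(0, i)})"

end

theory Submission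
  imports Defs
begin

text \<open>
  The sets obtained by iterating the dual substitution are connected only in a coarse sense: any two
  faces are joined by a chain inside the set whose consecutive members lie in a common translate of one of
  finitely many patterns.  This property is inherited by images under the dual Brun and Jacobi--Perron substitutions for a
  suitable choice of patterns.  Shrinking by the contraction on the plane turns the chains into
  chains of overlapping balls; these unions of balls can be chosen nested, so that their intersection is
  connected and is the Hausdorff limit.

  The contraction is elementary: if \<open>l\<close> is a positive left eigenvector, then on the plane orthogonal to \<open>l\<close>
  each factor replaces one entry of a vector by a combination whose modulus is strictly less than the
  maximum norm, because the entries of \<open>l\<close> are suitably ordered.  The remaining spectral
  information (the plane is spanned by two contracting complex eigenvectors) follows from the
  Cayley--Hamilton theorem, a double eigenvalue being excluded because it would be a nonzero rational integer of modulus less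
  than one.
\<close>

subsection \<open>Dual substitutions\<close>

text \<open>Chains are used because connectedness of the union of squares need not be inherited:
  iterated images of two squares with a common edge may lie apart. A suitable family of patterns
  arises by closure: take the pairs met inside the image of a single face, then add for each pair
  one pair that bridges the two images. This closes up after finitely many pairs, with offsets
  independent of the parameters \<open>a\<close> and \<open>b\<close>, so that invariance becomes a
  finite check. Brouwer's theorem yields a left eigenvector only in a closed cone, whereas the
  estimate needs strict inequalities between its entries; and each application of the matrix is only
  guaranteed to push one further entry of a vector strictly below the norm. Both are therefore
  gained in stages: four strict inequalities for the row in four applications, three small entries
  of the column in three. This is where the indices 4 and 3 and the third power come from.\<close>

lemma matrix_inv_vector_eq_iff:
  fixes A :: "'a::semiring_1^'n^'n"
  assumes "invertible A"
  shows "matrix_inv A *v x = y \<longleftrightarrow> A *v y = x"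
proof -
  have "A ** matrix_inv A = mat 1" "matrix_inv A ** A = mat 1"
    using someI_ex[OF assms[unfolded invertible_def]] unfolding matrix_inv_def by auto
  then have "A *v (matrix_inv A *v z) = z" "matrix_inv A *v (A *v z) = z" for z
    by (simp_all add: matrix_vector_mul_assoc)
  then show ?thesis by auto
qed

lemma abelianization_simps [simp]:
  "abelianization [] = 0"
  "abelianization (a # w) = axis a 1 + abelianization w"
  "abelianization (v @ w) = abelianization v + abelianization w"
  by (simp_all add: abelianization_def vec_eq_iff axis_def)

lemma incidence_matrix_mult_axis: "incidence_matrix \<sigma> *v axis a 1 = abelianization (\<sigma> a)"
  by (simp add: incidence_matrix_def vec_eq_iff matrix_vector_mult_def axis_def if_distrib[of "(*) _"] cong: if_cong)

lemma subst_word_simps [simp]: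
  "subst_word \<sigma> [] = []"
  "subst_word \<sigma> (a # w) = \<sigma> a @ subst_word \<sigma> w"
  "subst_word \<sigma> (v @ w) = subst_word \<sigma> v @ subst_word \<sigma> w"
  by (simp_all add: subst_word_def)

lemma abelianization_subst_word:
  "abelianization (subst_word \<sigma> w) = incidence_matrix \<sigma> *v abelianization w"
  by (induction w) (simp_all add: matrix_vector_right_distrib incidence_matrix_mult_axis)

lemma incidence_matrix_subst_comp:
  "incidence_matrix (subst_comp \<sigma> \<tau>) = incidence_matrix \<sigma> ** incidence_matrix \<tau>"
proof -
  have "incidence_matrix (subst_comp \<sigma> \<tau>) $ r $ c = (incidence_matrix \<sigma> ** incidence_matrix \<tau>) $ r $ c" for r c
  proof -
    have "incidence_matrix (subst_comp \<sigma> \<tau>) $ r $ c = (incidence_matrix \<sigma> *v abelianization (\<tau> c)) $ r"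
      by (simp add: incidence_matrix_def[of "subst_comp \<sigma> \<tau>"])
        (simp add: subst_comp_def abelianization_subst_word)
    also have "\<dots> = (incidence_matrix \<sigma> ** incidence_matrix \<tau>) $ r $ c"
      by (simp add: matrix_matrix_mult_def matrix_vector_mult_def incidence_matrix_def[of \<tau>])
    finally show ?thesis .
  qed
  then show ?thesis by (simp add: vec_eq_iff)
qed

lemma incidence_matrix_id: "incidence_matrix (\<lambda>a. [a]) = mat 1"
  by (simp add: incidence_matrix_def vec_eq_iff mat_def axis_def)

lemma subst_prod_simps [simp]:
  "subst_prod [] = (\<lambda>a. [a])"
  "subst_prod (\<sigma> # \<sigma>s) = subst_comp \<sigma> (subst_prod \<sigma>s)"
  by (simp_all add: subst_prod_def)

lemma invertible_incidence_subst_prod: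
  assumes "\<And>\<sigma>. \<sigma> \<in> set \<sigma>s \<Longrightarrow> invertible (incidence_matrix \<sigma>)"
  shows "invertible (incidence_matrix (subst_prod \<sigma>s))"
  using assms
proof (induction \<sigma>s)
  case Nil
  have "mat 1 ** mat 1 = (mat 1 :: int^3^3)" by simp
  then show ?case unfolding invertible_def subst_prod_simps incidence_matrix_id by blast
next
  case (Cons \<sigma> \<sigma>s)
  then show ?case by (simp add: incidence_matrix_subst_comp invertible_mult)
qed

text \<open>Trades the inverse matrix for the equation \<open>M y = x + P(s)\<close>, so that
  explicit faces can be checked without inverting anything.\<close>

lemma E1_star_iff:
  assumes "invertible (incidence_matrix \<sigma>)"
  shows "(y, j) \<in> E1_star \<sigma> F \<longleftrightarrow>
    (\<exists>x i p s. (x, i) \<in> F \<and> \<sigma> j = p @ i # s \<and> incidence_matrix \<sigma> *v y = x + abelianization s)"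
proof -
  have "(y, j) \<in> E1_star \<sigma> F \<longleftrightarrow> (\<exists>x i p s. (x, i) \<in> F \<and> \<sigma> j = p @ i # s \<and>
      matrix_inv (incidence_matrix \<sigma>) *v (x + abelianization s) = y)"
    unfolding E1_star_def by auto
  then show ?thesis unfolding matrix_inv_vector_eq_iff[OF assms] .
qed

text \<open>An occurrence of \<open>i\<close> in the image word falls into the block of some letter
  \<open>k\<close>; what follows it is the rest of that block and then the images of the letters
  after \<open>k\<close>.\<close>

lemma subst_word_split:
  assumes "subst_word \<sigma> w = p @ i # s"
  obtains p' k s' p'' s'' where "w = p' @ k # s'" "\<sigma> k = p'' @ i # s''" "s = s'' @ subst_word \<sigma> s'"
  using assms
proof (induction w arbitrary: p thesis)
  case Nil
  then show ?case by simp
next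
  case (Cons a w)
  show ?case
  proof (cases "length p < length (\<sigma> a)")
    case True
    then obtain s'' where "\<sigma> a = p @ i # s''" "s = s'' @ subst_word \<sigma> w"
      using Cons.prems(2) by (auto simp: append_eq_append_conv2 append_eq_Cons_conv Cons_eq_append_conv)
    then show ?thesis using Cons.prems(1)[of "[]" a w p s''] by simp
  next
    case False
    then obtain q where q: "p = \<sigma> a @ q" "subst_word \<sigma> w = q @ i # s"
      using Cons.prems(2) by (auto simp: append_eq_append_conv2 append_eq_Cons_conv Cons_eq_append_conv)
    show ?thesis
      by (rule Cons.IH[OF _ q(2)], rule Cons.prems(1)[of "a # _"]) auto
  qed
qed

text \<open>The order reverses, so the leftmost factor of a product acts first on faces. The
  intermediate face sits at \<open>N y - P(s')\<close>, where \<open>N\<close> is the matrix of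
  \<open>\<tau>\<close> and \<open>s'\<close> is the suffix of \<open>\<tau> j\<close> behind the
  letter whose block contains the occurrence.\<close>

lemma E1_star_subst_comp:
  assumes "invertible (incidence_matrix \<sigma>)" "invertible (incidence_matrix \<tau>)"
  shows "E1_star (subst_comp \<sigma> \<tau>) F = E1_star \<tau> (E1_star \<sigma> F)"
proof -
  let ?M = "incidence_matrix \<sigma>" and ?N = "incidence_matrix \<tau>"
  have inv: "invertible (incidence_matrix (subst_comp \<sigma> \<tau>))"
    using assms by (simp add: incidence_matrix_subst_comp invertible_mult)
  have "(y, j) \<in> E1_star (subst_comp \<sigma> \<tau>) F \<longleftrightarrow> (y, j) \<in> E1_star \<tau> (E1_star \<sigma> F)" for y j
  proof
    assume "(y, j) \<in> E1_star (subst_comp \<sigma> \<tau>) F"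
    then obtain x i p s where 1: "(x, i) \<in> F" "subst_word \<sigma> (\<tau> j) = p @ i # s"
      "?M *v (?N *v y) = x + abelianization s"
      unfolding E1_star_iff[OF inv] incidence_matrix_subst_comp matrix_vector_mul_assoc[symmetric]
      unfolding subst_comp_def by blast
    obtain p' k s' p'' s'' where 2: "\<tau> j = p' @ k # s'" "\<sigma> k = p'' @ i # s''" "s = s'' @ subst_word \<sigma> s'"
      using 1(2) by (rule subst_word_split)
    have "?M *v (?N *v y - abelianization s') = x + abelianization s''"
      using 1(3) by (simp add: 2 abelianization_subst_word matrix_vector_mult_diff_distrib)
    then have "(?N *v y - abelianization s', k) \<in> E1_star \<sigma> F"
      unfolding E1_star_iff[OF assms(1)] using 1(1) 2(2) by blast
    then show "(y, j) \<in> E1_star \<tau> (E1_star \<sigma> F)"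
      unfolding E1_star_iff[OF assms(2)] using 2(1)
      by (intro exI[of _ "?N *v y - abelianization s'"] exI[of _ k] exI[of _ p'] exI[of _ s']) simp
  next
    assume "(y, j) \<in> E1_star \<tau> (E1_star \<sigma> F)"
    then obtain z k p' s' where 1: "(z, k) \<in> E1_star \<sigma> F" "\<tau> j = p' @ k # s'" "?N *v y = z + abelianization s'"
      unfolding E1_star_iff[OF assms(2)] by blast
    then obtain x i p'' s'' where 2: "(x, i) \<in> F" "\<sigma> k = p'' @ i # s''" "?M *v z = x + abelianization s''"
      unfolding E1_star_iff[OF assms(1)] by blast
    have "subst_comp \<sigma> \<tau> j = (subst_word \<sigma> p' @ p'') @ i # (s'' @ subst_word \<sigma> s')"
      by (simp add: subst_comp_def 1 2)
    moreover have "incidence_matrix (subst_comp \<sigma> \<tau>) *v y = x + abelianization (s'' @ subst_word \<sigma> s')"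
      by (simp add: incidence_matrix_subst_comp matrix_vector_mul_assoc[symmetric] 1 2
          matrix_vector_right_distrib abelianization_subst_word)
    ultimately show "(y, j) \<in> E1_star (subst_comp \<sigma> \<tau>) F"
      unfolding E1_star_iff[OF inv] using 2(1) by blast
  qed
  then show ?thesis unfolding set_eq_iff split_paired_All by blast
qed

lemma E1_star_id: "E1_star (\<lambda>a. [a]) F = F"
proof -
  have inv: "invertible (incidence_matrix (\<lambda>a. [a]))"
    using invertible_incidence_subst_prod[of "[]"] by simp
  have "(y, j) \<in> E1_star (\<lambda>a. [a]) F \<longleftrightarrow> (y, j) \<in> F" for y j
    unfolding E1_star_iff[OF inv] by (auto simp: incidence_matrix_id Cons_eq_append_conv)
  then show ?thesis unfolding set_eq_iff split_paired_All by blast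
qed

lemma E1_star_mono: "F \<subseteq> G \<Longrightarrow> E1_star \<sigma> F \<subseteq> E1_star \<sigma> G"
  unfolding E1_star_def by blast

lemma mem_E1_star_iff_face: "f \<in> E1_star \<sigma> F \<longleftrightarrow> (\<exists>g\<in>F. f \<in> E1_star \<sigma> {g})"
  unfolding E1_star_def by blast

text \<open>A suffix is fixed by the letter \<open>j\<close> and its starting position, so the words
  \<open>drop k (\<sigma> j)\<close> exhaust the candidates.\<close>

lemma finite_E1_star:
  assumes "finite F"
  shows "finite (E1_star \<sigma> F)"
proof -
  have "E1_star \<sigma> F \<subseteq> (\<lambda>((x, i), j, k). (matrix_inv (incidence_matrix \<sigma>) *v (x + abelianization (drop k (\<sigma> j))), j))
      ` (F \<times> (SIGMA j:UNIV. {..length (\<sigma> j)}))"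
  proof
    fix f assume "f \<in> E1_star \<sigma> F"
    then obtain x i p j s where "f = (matrix_inv (incidence_matrix \<sigma>) *v (x + abelianization s), j)"
      "(x, i) \<in> F" "\<sigma> j = p @ [i] @ s"
      unfolding E1_star_def by blast
    then show "f \<in> (\<lambda>((x, i), j, k). (matrix_inv (incidence_matrix \<sigma>) *v (x + abelianization (drop k (\<sigma> j))), j))
      ` (F \<times> (SIGMA j:UNIV. {..length (\<sigma> j)}))"
      by (intro image_eqI[of _ _ "((x, i), j, Suc (length p))"]) auto
  qed
  moreover have "finite (F \<times> (SIGMA j:(UNIV::3 set). {..length (\<sigma> j)}))"
    using assms by simp
  ultimately show ?thesis by (meson finite_imageI finite_subset)
qed

text \<open>A letter occurring in no image would give the incidence matrix a zero row.\<close>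

lemma E1_star_nonempty:
  assumes "invertible (incidence_matrix \<sigma>)"
  shows "E1_star \<sigma> {f} \<noteq> {}"
proof -
  obtain x i where f: "f = (x, i)" by fastforce
  have "\<exists>j. i \<in> set (\<sigma> j)"
  proof (rule ccontr)
    assume "\<nexists>j. i \<in> set (\<sigma> j)"
    then have "incidence_matrix \<sigma> $ i $ j = 0" for j
      by (simp add: incidence_matrix_def abelianization_def)
    then have "(incidence_matrix \<sigma> ** B) $ i $ i = 0" for B :: "int^3^3"
      by (simp add: matrix_matrix_mult_def)
    moreover obtain B where "incidence_matrix \<sigma> ** B = mat 1"
      using assms unfolding invertible_def by blast
    ultimately have "(mat 1 :: int^3^3) $ i $ i = 0" by metis
    then show False by (simp add: mat_def)
  qed
  then obtain j p s where "\<sigma> j = p @ [i] @ s" by (auto simp: in_set_conv_decomp)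
  then show ?thesis unfolding E1_star_def f by blast
qed

section \<open>Translated patterns and chains of faces\<close>

definition translate :: "int^3 \<Rightarrow> face set \<Rightarrow> face set" where
  "translate v Q = (\<lambda>(x, i). (v + x, i)) ` Q"

lemma translate_insert [simp]: "translate v {} = {}" "translate v (insert (x, i) Q) = insert (v + x, i) (translate v Q)"
  by (simp_all add: translate_def)

lemma mem_translate_iff: "(y, j) \<in> translate v Q \<longleftrightarrow> (y - v, j) \<in> Q"
proof
  assume "(y - v, j) \<in> Q"
  then show "(y, j) \<in> translate v Q"
    unfolding translate_def by (intro image_eqI[of _ _ "(y - v, j)"]) auto
qed (auto simp: translate_def)

lemma translate_translate: "translate v (translate w Q) = translate (v + w) Q"
  unfolding set_eq_iff split_paired_All mem_translate_iff by (simp add: algebra_simps)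

lemma translate_mono: "Q \<subseteq> R \<Longrightarrow> translate v Q \<subseteq> translate v R"
  by (auto simp: translate_def)

lemma E1_star_translate:
  assumes "invertible (incidence_matrix \<sigma>)"
  shows "E1_star \<sigma> (translate v F) = translate (matrix_inv (incidence_matrix \<sigma>) *v v) (E1_star \<sigma> F)"
proof -
  let ?M = "incidence_matrix \<sigma>"
  have M: "?M *v (matrix_inv ?M *v v) = v"
    using matrix_inv_vector_eq_iff[OF assms] by blast
  have "(y, j) \<in> E1_star \<sigma> (translate v F) \<longleftrightarrow> (y, j) \<in> translate (matrix_inv ?M *v v) (E1_star \<sigma> F)" for y j
  proof -
    have "(y, j) \<in> E1_star \<sigma> (translate v F) \<longleftrightarrow> 
      (\<exists>x i p s. (x - v, i) \<in> F \<and> \<sigma> j = p @ i # s \<and> ?M *v y = x + abelianization s)"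
      by (simp add: E1_star_iff[OF assms] mem_translate_iff)
    also have "\<dots> \<longleftrightarrow> (\<exists>x i p s. (x, i) \<in> F \<and> \<sigma> j = p @ i # s \<and> ?M *v y = (x + v) + abelianization s)"
    proof (intro iffI; elim exE conjE)
      fix x i p s assume "(x - v, i) \<in> F" "\<sigma> j = p @ i # s" "?M *v y = x + abelianization s"
      then show "\<exists>x i p s. (x, i) \<in> F \<and> \<sigma> j = p @ i # s \<and> ?M *v y = (x + v) + abelianization s"
        by (intro exI[of _ "x - v"] exI[of _ i] exI[of _ p] exI[of _ s]) simp
    next
      fix x i p s assume "(x, i) \<in> F" "\<sigma> j = p @ i # s" "?M *v y = (x + v) + abelianization s"
      then show "\<exists>x i p s. (x - v, i) \<in> F \<and> \<sigma> j = p @ i # s \<and> ?M *v y = x + abelianization s"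
        by (intro exI[of _ "x + v"] exI[of _ i] exI[of _ p] exI[of _ s]) simp
    qed
    also have "\<dots> \<longleftrightarrow> (\<exists>x i p s. (x, i) \<in> F \<and> \<sigma> j = p @ i # s \<and> ?M *v (y - matrix_inv ?M *v v) = x + abelianization s)"
      by (simp add: matrix_vector_mult_diff_distrib M algebra_simps)
    finally show ?thesis by (simp add: E1_star_iff[OF assms] mem_translate_iff)
  qed
  then show ?thesis unfolding set_eq_iff split_paired_All by blast
qed

text \<open>The whole translate has to lie in \<open>F\<close>, not just the two faces: its image
  then lies in the image of \<open>F\<close>, and links can be transported.\<close>

definition face_link :: "face set set \<Rightarrow> face set \<Rightarrow> (face \<times> face) set" where
  "face_link L F = {(f, g). \<exists>Q\<in>L. \<exists>v. f \<in> translate v Q \<and> g \<in> translate v Q \<and> translate v Q \<subseteq> F}"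

definition linked :: "face set set \<Rightarrow> face set \<Rightarrow> bool" where
  "linked L F \<longleftrightarrow> (\<forall>f\<in>F. \<forall>g\<in>F. (f, g) \<in> (face_link L F)\<^sup>*)"

lemma face_link_mono: "L \<subseteq> L' \<Longrightarrow> F \<subseteq> G \<Longrightarrow> face_link L F \<subseteq> face_link L' G"
  unfolding face_link_def by blast

lemma linked_singleton [simp]: "linked L {f}"
  by (simp add: linked_def)

lemma linked_pattern: "Q \<in> L \<Longrightarrow> linked L (translate v Q)"
  unfolding linked_def face_link_def by blast

lemma linked_translate:
  assumes "linked L F"
  shows "linked L (translate v F)"
proof -
  let ?t = "\<lambda>(x, i). (v + x, i)"
  have "(?t f, ?t g) \<in> (face_link L (translate v F))\<^sup>*" if "(f, g) \<in> (face_link L F)\<^sup>*" for f g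
    using that
  proof (induction rule: rtrancl_induct)
    case (step g h)
    obtain Q u where Q: "Q \<in> L" "g \<in> translate u Q" "h \<in> translate u Q" "translate u Q \<subseteq> F"
      using step(2) unfolding face_link_def by blast
    have "?t g \<in> translate (v + u) Q" "?t h \<in> translate (v + u) Q" "translate (v + u) Q \<subseteq> translate v F"
      using Q translate_mono[OF Q(4), of v] unfolding translate_translate[symmetric]
      by (force simp: translate_def)+
    then have "(?t g, ?t h) \<in> face_link L (translate v F)"
      unfolding face_link_def using Q(1) by blast
    then show ?case using step(3) by simp
  qed simp
  then show ?thesis using assms unfolding linked_def translate_def by blast
qed

lemma linked_Un:
  assumes "linked L F" "linked L G" "f \<in> F" "g \<in> G" "(f, g) \<in> (face_link L (F \<union> G))\<^sup>*" "(g, f) \<in> (face_link L (F \<union> G))\<^sup>*"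
  shows "linked L (F \<union> G)"
proof -
  have F: "(a, b) \<in> (face_link L (F \<union> G))\<^sup>*" if "a \<in> F" "b \<in> F" for a b
    using assms(1) that rtrancl_mono[OF face_link_mono[of L L F "F \<union> G"]] unfolding linked_def by blast
  have G: "(a, b) \<in> (face_link L (F \<union> G))\<^sup>*" if "a \<in> G" "b \<in> G" for a b
    using assms(2) that rtrancl_mono[OF face_link_mono[of L L G "F \<union> G"]] unfolding linked_def by blast
  have FG: "(a, b) \<in> (face_link L (F \<union> G))\<^sup>*" if "a \<in> F" "b \<in> G" for a b
    by (rule rtrancl_trans[OF F[OF that(1) assms(3)] rtrancl_trans[OF assms(5) G[OF assms(4) that(2)]]])
  have GF: "(a, b) \<in> (face_link L (F \<union> G))\<^sup>*" if "a \<in> G" "b \<in> F" for a b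
    by (rule rtrancl_trans[OF G[OF that(1) assms(4)] rtrancl_trans[OF assms(6) F[OF assms(3) that(2)]]])
  show ?thesis unfolding linked_def using F G FG GF by blast
qed

lemma linked_Un_overlap:
  assumes "linked L F" "linked L G" "f \<in> F" "f \<in> G"
  shows "linked L (F \<union> G)"
  using linked_Un[OF assms(1-4)] by blast

lemma linked_Un_bridge:
  assumes "linked L F" "linked L G" "Q \<in> L" "translate v Q \<subseteq> F \<union> G"
    "f \<in> translate v Q" "f \<in> F" "g \<in> translate v Q" "g \<in> G"
  shows "linked L (F \<union> G)"
  by (rule linked_Un[OF assms(1,2,6,8)]) (use assms in \<open>auto simp: face_link_def intro!: r_into_rtrancl\<close>)

text \<open>Chains are transported link by link: two consecutive faces lie in a translated pattern,
  whose image is linked by \<open>pat\<close>. Source and target families are kept apart because the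
  Jacobi-Perron family depends on the preceding factor.\<close>

lemma linked_E1_star:
  assumes inv: "invertible (incidence_matrix \<sigma>)"
    and face: "\<And>i. linked L' (E1_star \<sigma> {(0, i)})"
    and pat: "\<And>Q. Q \<in> L \<Longrightarrow> linked L' (E1_star \<sigma> Q)"
    and F: "linked L F"
  shows "linked L' (E1_star \<sigma> F)"
proof -
  let ?R = "(face_link L' (E1_star \<sigma> F))\<^sup>*"
  have up: "(f, g) \<in> ?R" if "linked L' (E1_star \<sigma> G)" "G \<subseteq> F" "f \<in> E1_star \<sigma> G" "g \<in> E1_star \<sigma> G" for f g G
    using that rtrancl_mono[OF face_link_mono[OF order.refl E1_star_mono[OF that(2)]]] unfolding linked_def by blast
  have face': "linked L' (E1_star \<sigma> {h})" for h
  proof -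
    obtain x i where h: "h = (x, i)" by fastforce
    have "{h} = translate x {(0, i)}" by (simp add: h)
    then show ?thesis using E1_star_translate[OF inv] linked_translate[OF face] by metis
  qed
  have path: "\<forall>f\<in>E1_star \<sigma> {a}. \<forall>g\<in>E1_star \<sigma> {b}. (f, g) \<in> ?R" if "(a, b) \<in> (face_link L F)\<^sup>*" "a \<in> F" for a b
    using that
  proof (induction rule: rtrancl_induct)
    case base
    then show ?case using up[OF face'[of a]] by blast
  next
    case (step b c)
    obtain Q v where Q: "Q \<in> L" "b \<in> translate v Q" "c \<in> translate v Q" "translate v Q \<subseteq> F"
      using step(2) unfolding face_link_def by blast
    have l: "linked L' (E1_star \<sigma> (translate v Q))"
      using linked_translate[OF pat[OF Q(1)]] E1_star_translate[OF inv] by metis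
    \<comment> \<open>Any child of \<open>b\<close> serves as junction between the chain built so
      far and the image of the next link.\<close>
    obtain h where h: "h \<in> E1_star \<sigma> {b}" using E1_star_nonempty[OF inv] by blast
    have sub: "E1_star \<sigma> {b} \<subseteq> E1_star \<sigma> (translate v Q)" "E1_star \<sigma> {c} \<subseteq> E1_star \<sigma> (translate v Q)"
      using Q by (auto intro!: E1_star_mono)
    have "(h, g) \<in> ?R" if "g \<in> E1_star \<sigma> {c}" for g
      using up[OF l Q(4)] h that sub by blast
    then show ?case using step(3)[OF step(4)] h by (meson rtrancl_trans)
  qed
  show ?thesis unfolding linked_def
  proof (intro ballI)
    fix f g assume "f \<in> E1_star \<sigma> F" "g \<in> E1_star \<sigma> F"
    then obtain a b where "a \<in> F" "b \<in> F" "f \<in> E1_star \<sigma> {a}" "g \<in> E1_star \<sigma> {b}"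
      using mem_E1_star_iff_face by meson
    then show "(f, g) \<in> ?R" using path F unfolding linked_def by blast
  qed
qed

section \<open>Incidence matrices of the Brun and Jacobi-Perron substitutions\<close>

lemma count_list_replicate: "count_list (replicate n x) y = (if x = y then n else 0)"
  by (induction n) auto

lemma incidence_brun_mult:
  "incidence_matrix (brun 1) *v x = vector [x $ 1, x $ 2 + x $ 3, x $ 3]"
  "incidence_matrix (brun 2) *v x = vector [x $ 1, x $ 3, x $ 2 + x $ 3]"
  "incidence_matrix (brun 3) *v x = vector [x $ 3, x $ 1, x $ 2 + x $ 3]"
  by (simp_all add: incidence_matrix_def abelianization_def brun_def vec_eq_iff forall_3
      matrix_vector_mult_def sum_3)

lemma incidence_jacobi_perron_mult:
  "incidence_matrix (jacobi_perron (a, b)) *v x = vector [x $ 2, x $ 3, x $ 1 + int a * x $ 2 + int b * x $ 3]"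
  by (simp add: incidence_matrix_def abelianization_def jacobi_perron_def vec_eq_iff forall_3
      matrix_vector_mult_def sum_3 count_list_replicate)

lemma invertible_incidence_jacobi_perron: "invertible (incidence_matrix (jacobi_perron p))"
proof (cases p)
  case (Pair a b)
  show ?thesis unfolding Pair invertible_def
    by (rule exI[of _ "vector [vector [- int a, - int b, 1], vector [1, 0, 0], vector [0, 1, 0]]"])
      (simp add: incidence_matrix_def abelianization_def jacobi_perron_def vec_eq_iff forall_3
        matrix_matrix_mult_def sum_3 mat_def count_list_replicate)
qed

lemma invertible_incidence_brun: "invertible (incidence_matrix (brun k))"
proof -
  have "invertible (incidence_matrix (brun 1))"
    unfolding invertible_def
    by (rule exI[of _ "vector [vector [1, 0, 0], vector [0, 1, -1], vector [0, 0, 1]]"])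
      (simp add: incidence_matrix_def abelianization_def brun_def vec_eq_iff forall_3
        matrix_matrix_mult_def sum_3 mat_def)
  moreover have "invertible (incidence_matrix (brun 2))"
    unfolding invertible_def
    by (rule exI[of _ "vector [vector [1, 0, 0], vector [0, -1, 1], vector [0, 1, 0]]"])
      (simp add: incidence_matrix_def abelianization_def brun_def vec_eq_iff forall_3
        matrix_matrix_mult_def sum_3 mat_def)
  moreover have "invertible (incidence_matrix (brun 3))"
    unfolding invertible_def
    by (rule exI[of _ "vector [vector [0, 1, 0], vector [-1, 0, 1], vector [1, 0, 0]]"])
      (simp add: incidence_matrix_def abelianization_def brun_def vec_eq_iff forall_3
        matrix_matrix_mult_def sum_3 mat_def)
  ultimately show ?thesis using exhaust_3[of k] by auto
qed

subsection \<open>Contraction for admissible products\<close>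

lemma real_incidence_matrix_nth: "real_incidence_matrix \<sigma> $ i $ j = real_of_int (incidence_matrix \<sigma> $ i $ j)"
  by (simp add: real_incidence_matrix_def)


lemma real_incidence_matrix_subst_comp:
  "real_incidence_matrix (subst_comp \<sigma> \<tau>) = real_incidence_matrix \<sigma> ** real_incidence_matrix \<tau>"
  by (simp add: vec_eq_iff real_incidence_matrix_nth incidence_matrix_subst_comp matrix_matrix_mult_def)

lemma real_incidence_matrix_id: "real_incidence_matrix (\<lambda>a. [a]) = mat 1"
  by (simp add: vec_eq_iff real_incidence_matrix_nth incidence_matrix_id mat_def)

text \<open>Brouwer's theorem for the normalised map on the slice of \<open>K\<close> with
  coordinate sum 1, which is compact since the sum equals the l1 norm there. Prescribing the cone
  makes the eigenvector satisfy the inequalities that define \<open>K\<close>.\<close>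

lemma perron_vector:
  fixes A :: "real^'n^'n"
  assumes K: "closed K" "convex K" "\<And>x c. x \<in> K \<Longrightarrow> 0 \<le> c \<Longrightarrow> c *\<^sub>R x \<in> K"
    and nonneg: "\<And>x i. x \<in> K \<Longrightarrow> 0 \<le> x $ i"
    and ex: "\<exists>x\<in>K. x \<noteq> 0"
    and A: "\<And>x. x \<in> K - {0} \<Longrightarrow> x v* A \<in> K - {0}"
  obtains l \<kappa> where "l \<in> K - {0}" "0 < \<kappa>" "l v* A = \<kappa> *\<^sub>R l"
proof -
  define e :: "real^'n \<Rightarrow> real" where "e x = (\<Sum>i\<in>UNIV. x $ i)" for x
  have e_scale: "e (c *\<^sub>R x) = c * e x" for c x by (simp add: e_def sum_distrib_left)
  have e_pos: "0 < e x" if x: "x \<in> K - {0}" for x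
  proof -
    obtain i where "x $ i \<noteq> 0" using x by (auto simp: vec_eq_iff)
    then have "0 < x $ i" using nonneg[of x i] x by simp
    then show ?thesis unfolding e_def using nonneg x by (intro sum_pos2[of _ i]) auto
  qed
  have cont_e: "continuous_on S e" for S unfolding e_def by (intro continuous_intros)
  define S where "S = K \<inter> {x. e x = 1}"
  have closed: "closed {x. e x = 1}" using cont_e by (intro closed_Collect_eq) auto
  have "bounded S"
  proof (rule boundedI)
    fix x assume x: "x \<in> S"
    have "norm x \<le> (\<Sum>i\<in>UNIV. \<bar>x $ i\<bar>)" by (rule norm_le_l1_cart)
    also have "\<dots> = e x" unfolding e_def using x nonneg by (auto simp: S_def intro!: sum.cong)
    finally show "norm x \<le> 1" using x by (simp add: S_def)
  qed
  then have "compact S"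
    using K closed by (simp add: S_def compact_eq_bounded_closed closed_Int)
  moreover have "convex S"
  proof -
    have "convex {x. e x = 1}"
      by (rule convexI) (simp add: e_def sum.distrib flip: sum_distrib_left)
    then show ?thesis unfolding S_def by (intro convex_Int K)
  qed
  moreover have norm_S: "x /\<^sub>R e x \<in> S" if "x \<in> K - {0}" for x
    using that K(3)[of x "inverse (e x)"] e_pos[OF that] by (simp add: S_def e_scale)
  have "S \<noteq> {}" using norm_S ex by blast
  moreover have SK: "x \<in> K - {0}" if "x \<in> S" for x
    using that by (auto simp: S_def e_def)
  have "continuous_on S (\<lambda>x. x v* A /\<^sub>R e (x v* A))"
  proof -
    have lin: "continuous_on S (\<lambda>x. x v* A)"
      unfolding transpose_matrix_vector[symmetric] by (rule linear_continuous_on[OF matrix_vector_mul_bounded_linear])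
    show ?thesis
    proof (rule continuous_on_scaleR[OF continuous_on_inverse lin])
      show "continuous_on S (\<lambda>x. e (x v* A))"
        by (rule continuous_on_compose2[OF cont_e lin subset_UNIV])
      show "\<forall>x\<in>S. e (x v* A) \<noteq> 0" using e_pos[OF A[OF SK]] by (metis less_irrefl)
    qed
  qed
  moreover have "(\<lambda>x. x v* A /\<^sub>R e (x v* A)) \<in> S \<rightarrow> S"
    using norm_S[OF A[OF SK]] by blast
  ultimately obtain l where l: "l \<in> S" "l v* A /\<^sub>R e (l v* A) = l"
    by (rule brouwer) blast+
  have "0 < e (l v* A)" by (rule e_pos[OF A[OF SK[OF l(1)]]])
  moreover from this have "l v* A = e (l v* A) *\<^sub>R l" by (subst (3) l(2)[symmetric]) simp
  ultimately show ?thesis using that[OF SK[OF l(1)]] by blast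
qed

lemma infnorm_less_cart:
  fixes x :: "real^'n"
  assumes "\<And>i. \<bar>x $ i\<bar> < m"
  shows "infnorm x < m"
  unfolding infnorm_Max using assms
  by (subst Max_less_iff) (auto simp: Basis_vec_def inner_axis)

text \<open>The sets \<^term>\<open>C r\<close> record that a row vector has already become more and more positive;
  \<^term>\<open>S r m x\<close> says that all entries of \<^term>\<open>x\<close> are bounded by \<^term>\<open>m\<close> and that all but \<^term>\<open>r\<close> of them,
  in a suitable order, are strictly below \<^term>\<open>m\<close>.  The invariants survive weak steps and improve under strong ones.\<close>

definition weak_step :: "(nat \<Rightarrow> (real^3) set) \<Rightarrow> (nat \<Rightarrow> real \<Rightarrow> real^3 \<Rightarrow> bool) \<Rightarrow> real^3^3 \<Rightarrow> bool" where
  "weak_step C S A \<longleftrightarrow> (\<forall>r. \<forall>l\<in>C r. l v* A \<in> C r) \<and> (\<forall>l\<in>C 4. l $ 3 \<le> (l v* A) $ 3) \<and>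
    (\<forall>r m x. \<forall>l\<in>C 4. 0 < m \<longrightarrow> (l v* A) \<bullet> x = 0 \<longrightarrow> S r m x \<longrightarrow> S r m (A *v x))"

text \<open>One strong step gains one strict inequality for the row and one strictly bounded entry
  for the column. The strict growth of the third entry of \<open>l\<close> is what later forces
  \<open>1 < \<kappa>\<close>.\<close>

definition strong_step :: "(nat \<Rightarrow> (real^3) set) \<Rightarrow> (nat \<Rightarrow> real \<Rightarrow> real^3 \<Rightarrow> bool) \<Rightarrow> real^3^3 \<Rightarrow> bool" where
  "strong_step C S A \<longleftrightarrow> weak_step C S A \<and> (\<forall>r. \<forall>l\<in>C r. l v* A \<in> C (Suc r)) \<and> (\<forall>l\<in>C 4. l $ 3 < (l v* A) $ 3) \<and>
    (\<forall>r m x. \<forall>l\<in>C 4. 0 < m \<longrightarrow> (l v* A) \<bullet> x = 0 \<longrightarrow> S (Suc r) m x \<longrightarrow> S r m (A *v x))"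

lemma weak_step_id: "weak_step C S (mat 1)"
  by (simp add: weak_step_def)

lemma weak_stepD:
  assumes "weak_step C S A"
  shows "l \<in> C r \<Longrightarrow> l v* A \<in> C r" "l \<in> C 4 \<Longrightarrow> l $ 3 \<le> (l v* A) $ 3"
    "l \<in> C 4 \<Longrightarrow> 0 < m \<Longrightarrow> (l v* A) \<bullet> x = 0 \<Longrightarrow> S r m x \<Longrightarrow> S r m (A *v x)"
  using assms unfolding weak_step_def by blast+

lemma strong_stepD:
  assumes "strong_step C S A"
  shows "weak_step C S A" "l \<in> C r \<Longrightarrow> l v* A \<in> C (Suc r)" "l \<in> C 4 \<Longrightarrow> l $ 3 < (l v* A) $ 3"
    "l \<in> C 4 \<Longrightarrow> 0 < m \<Longrightarrow> (l v* A) \<bullet> x = 0 \<Longrightarrow> S (Suc r) m x \<Longrightarrow> S r m (A *v x)"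
  using assms unfolding strong_step_def by blast+

text \<open>Rows pass through \<open>A\<close> before \<open>B\<close>, columns through
  \<open>B\<close> before \<open>A\<close>. The orthogonality conditions of the two factors
  coincide, because \<open>(l v* A) \<bullet> (B *v x) = (l v* A v* B) \<bullet> x\<close>.\<close>

lemma weak_step_mult:
  assumes "weak_step C S A" "weak_step C S B"
  shows "weak_step C S (A ** B)"
proof -
  note A = weak_stepD[OF assms(1)] and B = weak_stepD[OF assms(2)]
  have orth: "(l v* A) \<bullet> (B *v x) = (l v* A v* B) \<bullet> x" for l x by (simp add: dot_lmul_matrix)
  have "l $ 3 \<le> (l v* A v* B) $ 3" if "l \<in> C 4" for l
    using A(2)[OF that] B(2)[OF A(1)[OF that]] by linarith
  moreover have "S r m (A *v (B *v x))" if "l \<in> C 4" "0 < m" "(l v* A v* B) \<bullet> x = 0" "S r m x" for r m x l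
    using A(3)[OF that(1,2)] B(3)[OF A(1)[OF that(1)] that(2,3,4)] that(3) by (simp add: orth)
  ultimately show ?thesis
    unfolding weak_step_def vector_matrix_mul_assoc[symmetric] matrix_vector_mul_assoc[symmetric]
    using A(1) B(1) by blast
qed

lemma strong_step_mult_left:
  assumes "strong_step C S A" "weak_step C S B"
  shows "strong_step C S (A ** B)"
proof -
  note A' = weak_stepD[OF strong_stepD(1)[OF assms(1)]] and A = strong_stepD[OF assms(1)] and B = weak_stepD[OF assms(2)]
  have orth: "(l v* A) \<bullet> (B *v x) = (l v* A v* B) \<bullet> x" for l x by (simp add: dot_lmul_matrix)
  have "l $ 3 < (l v* A v* B) $ 3" if "l \<in> C 4" for l
    using A(3)[OF that] B(2)[OF A'(1)[OF that]] by linarith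
  moreover have "S r m (A *v (B *v x))" if "l \<in> C 4" "0 < m" "(l v* A v* B) \<bullet> x = 0" "S (Suc r) m x" for r m x l
    using A(4)[OF that(1,2)] B(3)[OF A'(1)[OF that(1)] that(2,3,4)] that(3) by (simp add: orth)
  ultimately show ?thesis
    unfolding strong_step_def vector_matrix_mul_assoc[symmetric] matrix_vector_mul_assoc[symmetric]
    using A(2) B(1) weak_step_mult[OF A(1) assms(2)] by blast
qed

lemma strong_step_mult_right:
  assumes "weak_step C S A" "strong_step C S B"
  shows "strong_step C S (A ** B)"
proof -
  note A = weak_stepD[OF assms(1)] and B = strong_stepD[OF assms(2)]
  have orth: "(l v* A) \<bullet> (B *v x) = (l v* A v* B) \<bullet> x" for l x by (simp add: dot_lmul_matrix)
  have "l $ 3 < (l v* A v* B) $ 3" if "l \<in> C 4" for l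
    using A(2)[OF that] B(3)[OF A(1)[OF that]] by linarith
  moreover have "S r m (A *v (B *v x))" if "l \<in> C 4" "0 < m" "(l v* A v* B) \<bullet> x = 0" "S (Suc r) m x" for r m x l
    using A(3)[OF that(1,2)] B(4)[OF A(1)[OF that(1)] that(2,3,4)] that(3) by (simp add: orth)
  ultimately show ?thesis
    unfolding strong_step_def vector_matrix_mul_assoc[symmetric] matrix_vector_mul_assoc[symmetric]
    using A(1) B(2) weak_step_mult[OF assms(1) B(1)] by blast
qed

lemma weak_step_subst_prod:
  assumes "\<And>\<sigma>. \<sigma> \<in> set \<sigma>s \<Longrightarrow> weak_step C S (real_incidence_matrix \<sigma>)"
  shows "weak_step C S (real_incidence_matrix (subst_prod \<sigma>s))"
  using assms
  by (induction \<sigma>s) (simp_all add: real_incidence_matrix_id weak_step_id real_incidence_matrix_subst_comp weak_step_mult)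

lemma strong_step_subst_prod:
  assumes "\<And>\<sigma>. \<sigma> \<in> set \<sigma>s \<Longrightarrow> weak_step C S (real_incidence_matrix \<sigma>)"
    and "\<tau> \<in> set \<sigma>s" "strong_step C S (real_incidence_matrix \<tau>)"
  shows "strong_step C S (real_incidence_matrix (subst_prod \<sigma>s))"
  using assms
proof (induction \<sigma>s)
  case (Cons \<sigma> \<sigma>s)
  show ?case
  proof (cases "\<tau> = \<sigma>")
    case True
    then show ?thesis
      using Cons.prems weak_step_subst_prod[of \<sigma>s C S]
      by (simp add: real_incidence_matrix_subst_comp strong_step_mult_left)
  next
    case False
    then show ?thesis
      using Cons by (simp add: real_incidence_matrix_subst_comp strong_step_mult_right)
  qed
qed simp

text \<open>The fixed point of Brouwer's theorem only lies in the closed cone. Four applications of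
  the matrix multiply it by a positive number and carry it into \<open>C 4\<close>; rescaling shows
  that it was there already.\<close>

lemma strong_step_eigenvector:
  assumes step: "strong_step C S A"
    and K: "closed K" "convex K" "\<And>x c. x \<in> K \<Longrightarrow> 0 \<le> c \<Longrightarrow> c *\<^sub>R x \<in> K"
    and nonneg: "\<And>x i. x \<in> K \<Longrightarrow> 0 \<le> x $ i"
    and ex: "\<exists>x\<in>K. x \<noteq> 0"
    and C0: "C 0 = K - {0}"
    and scale: "\<And>c l. 0 < c \<Longrightarrow> c *\<^sub>R l \<in> C 4 \<Longrightarrow> l \<in> C 4"
    and C4: "\<And>l. l \<in> C 4 \<Longrightarrow> 0 < l $ 3"
  obtains l \<kappa> where "l \<in> C 4" "1 < \<kappa>" "l v* A = \<kappa> *\<^sub>R l"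
proof -
  have invariant: "x v* A \<in> K - {0}" if "x \<in> K - {0}" for x
    using weak_stepD(1)[OF strong_stepD(1)[OF step] that[folded C0]] unfolding C0 .
  obtain l \<kappa> where l: "l \<in> K - {0}" "0 < \<kappa>" "l v* A = \<kappa> *\<^sub>R l"
    by (rule perron_vector[OF K nonneg ex invariant])
  have "l \<in> C 0" using l(1) unfolding C0 .
  then have "l v* A v* A v* A v* A \<in> C (Suc (Suc (Suc (Suc 0))))"
    by (intro strong_stepD(2)[OF step])
  moreover have "l v* A v* A v* A v* A = (\<kappa> * (\<kappa> * (\<kappa> * \<kappa>))) *\<^sub>R l"
    by (simp add: l(3) scaleR_vector_matrix_assoc)
  moreover have "Suc (Suc (Suc (Suc 0))) = 4" by simp
  ultimately have "(\<kappa> * (\<kappa> * (\<kappa> * \<kappa>))) *\<^sub>R l \<in> C 4" by (simp only:)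
  moreover have "0 < \<kappa> * (\<kappa> * (\<kappa> * \<kappa>))" using l(2) by simp
  ultimately have l4: "l \<in> C 4" by (rule scale[rotated])
  have "l $ 3 < \<kappa> * l $ 3" using strong_stepD(3)[OF step l4] by (simp add: l(3))
  then have "1 < \<kappa>" using C4[OF l4] by simp
  then show ?thesis using that[OF l4] l(3) by blast
qed

text \<open>With \<open>m\<close> the maximum norm of \<open>x\<close>, the bound
  \<open>S 3 m x\<close> is free, and three strong steps lower it to \<open>S 0\<close>. The
  orthogonality required at each step persists because \<open>l\<close> is an eigenvector.\<close>

lemma strong_step_contracting:
  assumes step: "strong_step C S A" and l: "l \<in> C 4" "l v* A = \<kappa> *\<^sub>R l"
    and S3: "\<And>m x. (\<And>i. \<bar>x $ i\<bar> \<le> m) \<Longrightarrow> S 3 m x"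
    and S0: "\<And>m x i. S 0 m x \<Longrightarrow> \<bar>x $ i\<bar> < m"
    and x: "l \<bullet> x = 0" "x \<noteq> 0"
  shows "infnorm (((*v) A ^^ 3) x) < infnorm x"
proof -
  let ?m = "infnorm x"
  have m: "0 < ?m" using x(2) by (simp add: infnorm_pos_lt)
  have orth: "(l v* A) \<bullet> y = 0" if "l \<bullet> y = 0" for y using that by (simp add: l(2))
  have next_orth: "l \<bullet> (A *v y) = 0" if "l \<bullet> y = 0" for y
    using orth[OF that] by (simp add: dot_lmul_matrix)
  note step = strong_stepD(4)[OF step l(1) m orth]
  have "S 3 ?m x" by (rule S3) (rule component_le_infnorm_cart)
  then have "S (Suc (Suc (Suc 0))) ?m x" by (simp only: numeral_3_eq_3)
  then have "S (Suc (Suc 0)) ?m (A *v x)" by (rule step[OF x(1)])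
  then have "S (Suc 0) ?m (A *v (A *v x))" by (rule step[OF next_orth[OF x(1)]])
  then have "S 0 ?m (A *v (A *v (A *v x)))" by (rule step[OF next_orth[OF next_orth[OF x(1)]]])
  then have "infnorm (A *v (A *v (A *v x))) < ?m" by (intro infnorm_less_cart S0)
  then show ?thesis by (simp add: numeral_3_eq_3)
qed

text \<open>Everything that the geometric part takes from \<sigma>. The plane orthogonal to
  \<open>l\<close> turns out to be the contracting plane. The decrease is stated for the third
  power, since a single application may merely move an entry of maximal modulus.\<close>

locale contracting_incidence =
  fixes \<sigma> :: subst and \<kappa> :: real and l :: "real^3"
  assumes invertible: "invertible (incidence_matrix \<sigma>)"
    and expanding: "\<kappa> > 1"
    and left_eigenvector: "l v* real_incidence_matrix \<sigma> = \<kappa> *\<^sub>R l"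
    and nonzero: "l \<noteq> 0"
    and contracting: "\<And>x. l \<bullet> x = 0 \<Longrightarrow> x \<noteq> 0 \<Longrightarrow> infnorm (((*v) (real_incidence_matrix \<sigma>) ^^ 3) x) < infnorm x"

lemma contracting_incidence_strong_step:
  assumes inv: "invertible (incidence_matrix \<sigma>)"
    and step: "strong_step C S (real_incidence_matrix \<sigma>)"
    and K: "closed K" "convex K" "\<And>x c. x \<in> K \<Longrightarrow> 0 \<le> c \<Longrightarrow> c *\<^sub>R x \<in> K"
    and nonneg: "\<And>x i. x \<in> K \<Longrightarrow> 0 \<le> x $ i"
    and ex: "\<exists>x\<in>K. x \<noteq> 0"
    and C0: "C 0 = K - {0}"
    and scale: "\<And>c l. 0 < c \<Longrightarrow> c *\<^sub>R l \<in> C 4 \<Longrightarrow> l \<in> C 4"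
    and C4: "\<And>l. l \<in> C 4 \<Longrightarrow> 0 < l $ 3"
    and S3: "\<And>m x. (\<And>i. \<bar>x $ i\<bar> \<le> m) \<Longrightarrow> S 3 m x"
    and S0: "\<And>m x i. S 0 m x \<Longrightarrow> \<bar>x $ i\<bar> < m"
  shows "\<exists>\<kappa> l. contracting_incidence \<sigma> \<kappa> l"
  by (rule strong_step_eigenvector[OF step K nonneg ex C0 scale C4], assumption+, intro exI,
      rule contracting_incidence.intro[OF inv], assumption, assumption, force dest: C4,
      rule strong_step_contracting[OF step _ _ S3 S0])

text \<open>Ordered rows: undoing any of the three row maps subtracts the second entry from the
  third and sorts again, which is Brun's algorithm. The strict inequalities are listed in the order
  in which \<open>l \<mapsto> (l2, l3, l1 + l3)\<close>, the row map of \<open>brun 3\<close>,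
  produces them, each from the previous ones.\<close>

definition brun_cone :: "nat \<Rightarrow> (real^3) set" where
  "brun_cone r = {l. 0 \<le> l $ 1 \<and> l $ 1 \<le> l $ 2 \<and> l $ 2 \<le> l $ 3 \<and> 0 < l $ 3 \<and> (1 \<le> r \<longrightarrow> 0 < l $ 2) \<and>
    (2 \<le> r \<longrightarrow> 0 < l $ 1) \<and> (3 \<le> r \<longrightarrow> l $ 2 < l $ 3) \<and> (4 \<le> r \<longrightarrow> l $ 1 < l $ 2)}"

text \<open>Entries become strict in the order 3, 1, 2: \<open>brun 3\<close> sends \<open>x\<close>
  to \<open>(x3, x1, x2 + x3)\<close>, creating a small third entry and moving earlier small ones
  from place 3 to 1 and from 1 to 2.\<close>

definition brun_bound :: "nat \<Rightarrow> real \<Rightarrow> real^3 \<Rightarrow> bool" where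
  "brun_bound r m x \<longleftrightarrow> \<bar>x $ 1\<bar> \<le> m \<and> \<bar>x $ 2\<bar> \<le> m \<and> \<bar>x $ 3\<bar> \<le> m \<and>
    (r \<le> 2 \<longrightarrow> \<bar>x $ 3\<bar> < m) \<and> (r \<le> 1 \<longrightarrow> \<bar>x $ 1\<bar> < m) \<and> (r = 0 \<longrightarrow> \<bar>x $ 2\<bar> < m)"

text \<open>If \<open>x2 + x3\<close> had modulus at least \<open>m\<close>, then \<open>x2\<close> and \<open>x3\<close> would have equal signs, and orthogonality
  would force \<open>x1\<close> to be larger than \<open>m\<close>.\<close>

lemma brun_entry_bound:
  fixes x1 x2 x3 :: real
  assumes l: "0 < l1" "l1 < l2" "l2 \<le> l3" and orth: "l1 * x1 + l2 * x2 + l3 * x3 = 0"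
    and m: "0 < m" "\<bar>x1\<bar> \<le> m" "\<bar>x2\<bar> \<le> m" "\<bar>x3\<bar> \<le> m"
  shows "\<bar>x2 + x3\<bar> < m"
proof -
  have *: "y2 + y3 < m" if o: "l1 * y1 + l2 * y2 + l3 * y3 = 0" and y: "\<bar>y1\<bar> \<le> m" "y2 \<le> m" "y3 \<le> m" for y1 y2 y3
  proof (rule ccontr)
    assume "\<not> y2 + y3 < m"
    then have y3: "0 \<le> y3" "m \<le> y2 + y3" using y by linarith+
    have "l1 * m < l2 * m" using l m by simp
    also have "\<dots> \<le> l2 * (y2 + y3)" using l y3 by simp
    also have "\<dots> \<le> l2 * y2 + l3 * y3" using l y3 by (simp add: distrib_left mult_right_mono)
    also have "\<dots> = l1 * (- y1)" using o by simp
    also have "\<dots> \<le> l1 * m" using l y by (intro mult_left_mono) auto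
    finally show False by simp
  qed
  have "x2 + x3 < m" by (rule *[OF orth]) (use m in auto)
  moreover have "- x2 + - x3 < m"
    by (rule *[of "- x1"]) (use m orth in \<open>auto simp: algebra_simps\<close>)
  ultimately show ?thesis by linarith
qed

lemma real_incidence_brun_mult:
  "real_incidence_matrix (brun 1) *v x = vector [x $ 1, x $ 2 + x $ 3, x $ 3]"
  "real_incidence_matrix (brun 2) *v x = vector [x $ 1, x $ 3, x $ 2 + x $ 3]"
  "real_incidence_matrix (brun 3) *v x = vector [x $ 3, x $ 1, x $ 2 + x $ 3]"
  "x v* real_incidence_matrix (brun 1) = vector [x $ 1, x $ 2, x $ 2 + x $ 3]"
  "x v* real_incidence_matrix (brun 2) = vector [x $ 1, x $ 3, x $ 2 + x $ 3]"
  "x v* real_incidence_matrix (brun 3) = vector [x $ 2, x $ 3, x $ 1 + x $ 3]"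
  by (simp_all add: real_incidence_matrix_nth incidence_matrix_def abelianization_def brun_def vec_eq_iff forall_3
      matrix_vector_mult_def vector_matrix_mult_def sum_3)

text \<open>The sum \<open>x2 + x3\<close> is the only entry of the three Brun images that is not
  copied from \<open>x\<close>.\<close>

lemma brun_bound_new_entry:
  assumes "L \<in> brun_cone 4" "0 < m" "L \<bullet> x = 0" "brun_bound r m x"
  shows "\<bar>x $ 2 + x $ 3\<bar> < m"
  by (rule brun_entry_bound[of "L $ 1" "L $ 2" "L $ 3" "x $ 1"])
    (use assms in \<open>auto simp: brun_cone_def brun_bound_def inner_vec_def sum_3\<close>)

lemma weak_step_brun: "weak_step brun_cone brun_bound (real_incidence_matrix (brun k))"
proof -
  have C: "l v* real_incidence_matrix (brun k) \<in> brun_cone r" if "l \<in> brun_cone r" for l r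
    using exhaust_3[of k] that by (elim disjE) (auto simp: brun_cone_def real_incidence_brun_mult)
  have "l $ 3 \<le> (l v* real_incidence_matrix (brun k)) $ 3" if "l \<in> brun_cone 4" for l
    using exhaust_3[of k] that by (elim disjE) (auto simp: brun_cone_def real_incidence_brun_mult)
  moreover have "brun_bound r m (real_incidence_matrix (brun k) *v x)"
    if "l \<in> brun_cone 4" "0 < m" "(l v* real_incidence_matrix (brun k)) \<bullet> x = 0" "brun_bound r m x" for l r m x
    using exhaust_3[of k] brun_bound_new_entry[OF C[OF that(1)] that(2-4)] that(4)
    by (elim disjE) (auto simp: brun_bound_def real_incidence_brun_mult)
  ultimately show ?thesis unfolding weak_step_def using C by blast
qed

lemma strong_step_brun: "strong_step brun_cone brun_bound (real_incidence_matrix (brun 3))"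
proof -
  have "l v* real_incidence_matrix (brun 3) \<in> brun_cone (Suc r)" if "l \<in> brun_cone r" for l r
    using that by (auto simp: brun_cone_def real_incidence_brun_mult)
  moreover have "l $ 3 < (l v* real_incidence_matrix (brun 3)) $ 3" if "l \<in> brun_cone 4" for l
    using that by (auto simp: brun_cone_def real_incidence_brun_mult)
  moreover have "brun_bound r m (real_incidence_matrix (brun 3) *v x)"
    if "l \<in> brun_cone 4" "0 < m" "(l v* real_incidence_matrix (brun 3)) \<bullet> x = 0" "brun_bound (Suc r) m x" for l r m x
    using brun_bound_new_entry[OF weak_stepD(1)[OF weak_step_brun that(1)] that(2-4)] that(4)
    by (auto simp: brun_bound_def real_incidence_brun_mult)
  ultimately show ?thesis unfolding strong_step_def using weak_step_brun by blast
qed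

text \<open>Unlike in the Brun case the row is not fully ordered: the middle entry may exceed the
  last one. Each strict inequality follows from the earlier ones under the row map
  \<open>l \<mapsto> (l3, l1 + a l3, l2 + b l3)\<close>.\<close>

definition jp_cone :: "nat \<Rightarrow> (real^3) set" where
  "jp_cone r = {l. 0 \<le> l $ 1 \<and> 0 \<le> l $ 2 \<and> l $ 1 \<le> l $ 3 \<and> l $ 2 \<le> l $ 1 + l $ 3 \<and> 0 < l $ 3 \<and>
    (1 \<le> r \<longrightarrow> 0 < l $ 1) \<and> (2 \<le> r \<longrightarrow> 0 < l $ 2) \<and> (3 \<le> r \<longrightarrow> l $ 1 < l $ 3) \<and>
    (4 \<le> r \<longrightarrow> l $ 2 < l $ 1 + l $ 3)}"

text \<open>The order 3, 2, 1 reflects that a Jacobi-Perron matrix shifts the entries one place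
  forward and puts the new one last.\<close>

definition jp_bound :: "nat \<Rightarrow> real \<Rightarrow> real^3 \<Rightarrow> bool" where
  "jp_bound r m x \<longleftrightarrow> \<bar>x $ 1\<bar> \<le> m \<and> \<bar>x $ 2\<bar> \<le> m \<and> \<bar>x $ 3\<bar> \<le> m \<and>
    (r \<le> 2 \<longrightarrow> \<bar>x $ 3\<bar> < m) \<and> (r \<le> 1 \<longrightarrow> \<bar>x $ 2\<bar> < m) \<and> (r = 0 \<longrightarrow> \<bar>x $ 1\<bar> < m)"

text \<open>Here \<open>(y1, y2, y3)\<close> with \<open>y3 = x + a y1 + b y2\<close> is the image
  vector, orthogonal to the row. If \<open>y3 \<ge> m\<close>, then
  \<open>l1 y1 + l2 y2 \<le> - l3 m\<close>. For \<open>y2 \<ge> 0\<close> this contradicts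
  \<open>l1 < l3\<close>; for \<open>y2 < 0\<close> and \<open>y1 \<ge> - y2\<close> it contradicts
  \<open>l2 < l1 + l3\<close>. In the remaining case \<open>a y1 + b y2 < 0\<close> by
  \<open>a \<le> b\<close> and \<open>b \<ge> 1\<close>, hence \<open>y3 < x \<le> m\<close>. The
  lower bound follows by changing all signs.\<close>

lemma jp_entry_bound:
  fixes x y1 y2 :: real
  assumes l: "0 < l1" "0 < l2" "l1 < l3" "l2 < l1 + l3" and ab: "0 \<le> a" "a \<le> b" "1 \<le> b"
    and orth: "l1 * y1 + l2 * y2 + l3 * (x + a * y1 + b * y2) = 0"
    and m: "0 < m" "\<bar>x\<bar> \<le> m" "\<bar>y1\<bar> \<le> m" "\<bar>y2\<bar> \<le> m"
  shows "\<bar>x + a * y1 + b * y2\<bar> < m"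
proof -
  have *: "x + a * y1 + b * y2 < m"
    if o: "l1 * y1 + l2 * y2 + l3 * (x + a * y1 + b * y2) = 0"
      and y: "x \<le> m" "\<bar>y1\<bar> \<le> m" "\<bar>y2\<bar> \<le> m" for x y1 y2
  proof (rule ccontr)
    define y3 where "y3 = x + a * y1 + b * y2"
    assume "\<not> x + a * y1 + b * y2 < m"
    then have y3: "m \<le> y3" by (simp add: y3_def)
    have o3: "l1 * y1 + l2 * y2 + l3 * y3 = 0" using o by (simp add: y3_def)
    have l3y3: "l3 * m \<le> l3 * y3" using l y3 by simp
    have lm: "l1 * m < l3 * m" using l m by simp
    have l1y1: "- (l1 * m) \<le> l1 * y1"
      using mult_left_mono[of "- m" y1 l1] y l by auto
    show False
    proof (cases "0 \<le> y2")
      case True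
      then have "0 \<le> l2 * y2" using l by simp
      then show False using o3 l3y3 lm l1y1 by linarith
    next
      case False
      show False
      proof (cases "0 < y1 + y2")
        case True
        have "l2 * - y2 < (l1 + l3) * - y2" using l False by (intro mult_strict_right_mono) auto
        moreover have "l1 * - y2 \<le> l1 * y1" using l True by (intro mult_left_mono) auto
        moreover have "l3 * - y2 \<le> l3 * m" using l y by (intro mult_left_mono) auto
        ultimately show False using o3 l3y3 by (simp add: algebra_simps)
      next
        case neg: False
        show False
        proof (cases "y1 = - y2")
          case True
          have "l2 * - y2 < (l1 + l3) * - y2" using l False by (intro mult_strict_right_mono) auto
          moreover have "l3 * - y2 \<le> l3 * m" using l y by (intro mult_left_mono) auto
          ultimately show False using o3 l3y3 True by (simp add: algebra_simps)
        next
          case ne: False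
          have "0 < - (a * y1 + b * y2)"
          proof (cases "0 \<le> y1")
            case True
            have "a * y1 \<le> b * y1" using ab True by (intro mult_right_mono)
            moreover have "b * y1 < b * - y2" using ab neg ne by (intro mult_strict_left_mono) auto
            ultimately show ?thesis by simp
          next
            case False
            have "a * y1 \<le> 0" using ab False by (simp add: mult_nonneg_nonpos)
            moreover have "b * y2 < 0" using ab \<open>\<not> 0 \<le> y2\<close> by (simp add: mult_pos_neg)
            ultimately show ?thesis by simp
          qed
          then show False using y3 y(1) unfolding y3_def by linarith
        qed
      qed
    qed
  qed
  have "x + a * y1 + b * y2 < m" by (rule *[OF orth]) (use m in auto)
  moreover have "- x + a * - y1 + b * - y2 < m"
    by (rule *) (use m orth in \<open>auto simp: algebra_simps\<close>)
  ultimately show ?thesis by (simp add: abs_less_iff)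
qed

lemma real_incidence_jacobi_perron_mult:
  "real_incidence_matrix (jacobi_perron (a, b)) *v x = vector [x $ 2, x $ 3, x $ 1 + real a * x $ 2 + real b * x $ 3]"
  "x v* real_incidence_matrix (jacobi_perron (a, b)) = vector [x $ 3, x $ 1 + real a * x $ 3, x $ 2 + real b * x $ 3]"
  by (simp_all add: real_incidence_matrix_nth incidence_matrix_def abelianization_def jacobi_perron_def vec_eq_iff
      forall_3 matrix_vector_mult_def vector_matrix_mult_def sum_3 count_list_replicate)

lemma jp_bound_new_entry:
  assumes "a \<le> b" "b \<noteq> 0" "l \<in> jp_cone 4" "0 < m" "jp_bound r m x"
    and "l \<bullet> (real_incidence_matrix (jacobi_perron (a, b)) *v x) = 0"
  shows "\<bar>x $ 1 + real a * x $ 2 + real b * x $ 3\<bar> < m"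
  by (rule jp_entry_bound[of "l $ 1" "l $ 2" "l $ 3"])
    (use assms in \<open>simp_all add: jp_cone_def jp_bound_def real_incidence_jacobi_perron_mult inner_vec_def sum_3\<close>)

lemma strong_step_jacobi_perron:
  assumes ab: "a \<le> b" "b \<noteq> 0"
  shows "strong_step jp_cone jp_bound (real_incidence_matrix (jacobi_perron (a, b)))"
proof -
  let ?M = "real_incidence_matrix (jacobi_perron (a, b))"
  have C: "l v* ?M \<in> jp_cone (Suc r)" if l: "l \<in> jp_cone r" for l r
  proof -
    have "real a * l $ 3 \<le> real b * l $ 3" "1 * l $ 3 \<le> real b * l $ 3" "0 \<le> real a * l $ 3"
      using l ab by (auto simp: jp_cone_def intro!: mult_right_mono)
    then show ?thesis using l
      unfolding jp_cone_def real_incidence_jacobi_perron_mult mem_Collect_eq vector_3 by linarith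
  qed
  have mono: "jp_cone (Suc r) \<subseteq> jp_cone r" for r by (auto simp: jp_cone_def)
  have g: "l $ 3 < (l v* ?M) $ 3" if "l \<in> jp_cone 4" for l
  proof -
    have "1 * l $ 3 \<le> real b * l $ 3" using that ab by (intro mult_right_mono) (auto simp: jp_cone_def)
    moreover have "0 < l $ 2" using that by (simp add: jp_cone_def)
    ultimately show ?thesis by (simp add: real_incidence_jacobi_perron_mult)
  qed
  have S: "jp_bound r m (?M *v x)"
    if x: "l \<in> jp_cone 4" "0 < m" "(l v* ?M) \<bullet> x = 0" "jp_bound (Suc r) m x" for l r m x
  proof -
    have "l \<bullet> (?M *v x) = 0" using x(3) by (simp add: dot_lmul_matrix)
    then have "\<bar>x $ 1 + real a * x $ 2 + real b * x $ 3\<bar> < m"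
      by (rule jp_bound_new_entry[OF ab x(1,2,4)])
    then show ?thesis using x(4) by (auto simp: jp_bound_def real_incidence_jacobi_perron_mult)
  qed
  have bound_mono: "jp_bound r m x \<Longrightarrow> jp_bound (Suc r) m x" for r m x by (simp add: jp_bound_def)
  have "weak_step jp_cone jp_bound ?M"
    unfolding weak_step_def using C mono g S bound_mono by (meson less_imp_le subsetD)
  then show ?thesis unfolding strong_step_def using C g S by blast
qed

text \<open>A single strong factor makes the product strong. In the Brun case it is
  \<open>brun 3\<close>: the other two fix the first coordinate, so products of these alone have
  eigenvalue 1. In the Jacobi-Perron case \<open>a \<le> b\<close> and \<open>b \<noteq> 0\<close>
  make every factor strong.\<close>

lemma contracting_incidence_admissible:
  assumes "(\<exists>ks. admissible_brun ks \<and> \<sigma> = subst_prod (map brun ks)) \<or>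
           (\<exists>ps. admissible_jacobi_perron ps \<and> \<sigma> = subst_prod (map jacobi_perron ps))"
  shows "\<exists>\<kappa> l. contracting_incidence \<sigma> \<kappa> l"
  using assms
proof (elim disjE exE conjE)
  fix ks assume ks: "admissible_brun ks" and \<sigma>: "\<sigma> = subst_prod (map brun ks)"
  show ?thesis unfolding \<sigma>
  proof (rule contracting_incidence_strong_step)
    let ?K = "{l :: real^3. 0 \<le> l $ 1 \<and> l $ 1 \<le> l $ 2 \<and> l $ 2 \<le> l $ 3}"
    show "invertible (incidence_matrix (subst_prod (map brun ks)))"
      by (rule invertible_incidence_subst_prod) (auto simp: invertible_incidence_brun)
    show "strong_step brun_cone brun_bound (real_incidence_matrix (subst_prod (map brun ks)))"
      using ks strong_step_brun weak_step_brun
      by (intro strong_step_subst_prod[of _ _ _ "brun 3"]) (auto simp: admissible_brun_def)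
    show "closed ?K" by (intro closed_Collect_conj closed_Collect_le continuous_intros)
    show "convex ?K" by (rule convexI) (auto intro!: add_mono mult_left_mono)
    show "c *\<^sub>R x \<in> ?K" if "x \<in> ?K" "0 \<le> c" for x c
      using that by (auto intro: mult_left_mono)
    show "0 \<le> x $ i" if "x \<in> ?K" for x i
      using that exhaust_3[of i] by auto
    show "\<exists>x\<in>?K. x \<noteq> 0" by (intro bexI[of _ "vector [1, 1, 1]"]) (auto simp: vec_eq_iff forall_3)
    show "brun_cone 0 = ?K - {0}" by (auto simp: brun_cone_def vec_eq_iff forall_3)
    show "l \<in> brun_cone 4" if "0 < c" "c *\<^sub>R l \<in> brun_cone 4" for c l
      using that by (auto simp: brun_cone_def zero_le_mult_iff zero_less_mult_iff)
    show "0 < l $ 3" if "l \<in> brun_cone 4" for l using that by (simp add: brun_cone_def)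
    show "brun_bound 3 m x" if "\<And>i. \<bar>x $ i\<bar> \<le> m" for m x using that by (simp add: brun_bound_def)
    show "\<bar>x $ i\<bar> < m" if "brun_bound 0 m x" for m x i
      using that exhaust_3[of i] by (auto simp: brun_bound_def)
  qed
next
  fix ps assume ps: "admissible_jacobi_perron ps" and \<sigma>: "\<sigma> = subst_prod (map jacobi_perron ps)"
  show ?thesis unfolding \<sigma>
  proof (rule contracting_incidence_strong_step)
    let ?K = "{l :: real^3. 0 \<le> l $ 1 \<and> 0 \<le> l $ 2 \<and> l $ 1 \<le> l $ 3 \<and> l $ 2 \<le> l $ 1 + l $ 3}"
    have step: "strong_step jp_cone jp_bound (real_incidence_matrix (jacobi_perron p))" if "p \<in> set ps" for p
      using ps that strong_step_jacobi_perron[of "fst p" "snd p"]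
      unfolding admissible_jacobi_perron_def in_set_conv_nth by auto
    show "invertible (incidence_matrix (subst_prod (map jacobi_perron ps)))"
      by (rule invertible_incidence_subst_prod) (auto simp: invertible_incidence_jacobi_perron)
    show "strong_step jp_cone jp_bound (real_incidence_matrix (subst_prod (map jacobi_perron ps)))"
      using ps step strong_stepD(1)[OF step]
      by (intro strong_step_subst_prod[of _ _ _ "jacobi_perron (hd ps)"]) (auto simp: admissible_jacobi_perron_def)
    show "closed ?K" by (intro closed_Collect_conj closed_Collect_le continuous_intros)
    show "convex ?K"
    proof (rule convexI)
      fix x y :: "real^3" and u v :: real
      assume x: "x \<in> ?K" and y: "y \<in> ?K" and uv: "0 \<le> u" "0 \<le> v"
      have "0 \<le> u * x $ 1 + v * y $ 1" "0 \<le> u * x $ 2 + v * y $ 2"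
        "u * x $ 1 + v * y $ 1 \<le> u * x $ 3 + v * y $ 3"
        "u * x $ 2 + v * y $ 2 \<le> u * (x $ 1 + x $ 3) + v * (y $ 1 + y $ 3)"
        using x y uv by (auto intro!: add_mono mult_left_mono)
      then show "u *\<^sub>R x + v *\<^sub>R y \<in> ?K" by (simp add: algebra_simps)
    qed
    show "c *\<^sub>R x \<in> ?K" if "x \<in> ?K" "0 \<le> c" for x c
      using that by (auto intro: mult_left_mono simp flip: distrib_left)
    show "0 \<le> x $ i" if "x \<in> ?K" for x i
      using that exhaust_3[of i] by auto
    show "\<exists>x\<in>?K. x \<noteq> 0" by (intro bexI[of _ "vector [1, 1, 1]"]) (auto simp: vec_eq_iff forall_3)
    show "jp_cone 0 = ?K - {0}" by (auto simp: jp_cone_def vec_eq_iff forall_3)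
    show "l \<in> jp_cone 4" if "0 < c" "c *\<^sub>R l \<in> jp_cone 4" for c l
      using that by (auto simp: jp_cone_def zero_le_mult_iff zero_less_mult_iff simp flip: distrib_left)
    show "0 < l $ 3" if "l \<in> jp_cone 4" for l using that by (simp add: jp_cone_def)
    show "jp_bound 3 m x" if "\<And>i. \<bar>x $ i\<bar> \<le> m" for m x using that by (simp add: jp_bound_def)
    show "\<bar>x $ i\<bar> < m" if "jp_bound 0 m x" for m x i
      using that exhaust_3[of i] by (auto simp: jp_bound_def)
  qed
qed

subsection \<open>Hausdorff limits\<close>

lemma infdist_le_hausdorff_distance:
  fixes A B :: "'a::metric_space set"
  assumes "bounded A" "bounded B" "B \<noteq> {}" "a \<in> A"
  shows "infdist a B \<le> hausdorff_distance A B"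
proof -
  obtain b where b: "b \<in> B" using assms by blast
  obtain e where e: "\<forall>x\<in>A. dist b x \<le> e" using bounded_any_center[of A b] assms by blast
  have "infdist x B \<le> e" if "x \<in> A" for x
    using infdist_le[OF b, of x] e that by (force simp: dist_commute)
  then have "bdd_above ((\<lambda>a. infdist a B) ` A)" by (intro bdd_aboveI2)
  then have "infdist a B \<le> (SUP a\<in>A. infdist a B)" using assms by (intro cSUP_upper)
  then show ?thesis unfolding hausdorff_distance_def by simp
qed

lemma hausdorff_distance_commute: "hausdorff_distance A B = hausdorff_distance B A"
  by (simp add: hausdorff_distance_def max.commute)

lemma hausdorff_distance_le:
  assumes "A \<noteq> {}" "B \<noteq> {}" "\<And>a. a \<in> A \<Longrightarrow> infdist a B \<le> e" "\<And>b. b \<in> B \<Longrightarrow> infdist b A \<le> e"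
  shows "hausdorff_distance A B \<le> e"
  unfolding hausdorff_distance_def using assms by (intro max.boundedI cSUP_least)

text \<open>Gives uniqueness of the limit, on which the definite description in
  \<open>hausdorff_limit\<close> depends.\<close>

lemma hausdorff_limit_subset:
  fixes A :: "nat \<Rightarrow> 'a::metric_space set"
  assumes A: "\<And>n. bounded (A n)" "\<And>n. A n \<noteq> {}" and "is_hausdorff_limit A S" "is_hausdorff_limit A T"
  shows "S \<subseteq> T"
proof
  fix x assume x: "x \<in> S"
  have S: "compact S" "S \<noteq> {}" "(\<lambda>n. hausdorff_distance (A n) S) \<longlonglongrightarrow> 0"
    and T: "compact T" "T \<noteq> {}" "(\<lambda>n. hausdorff_distance (A n) T) \<longlonglongrightarrow> 0"
    using assms unfolding is_hausdorff_limit_def by auto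
  \<comment> \<open>The infimum defining \<open>infdist x (A n)\<close> may not be attained. The
    factor 2 leaves room to choose a point of \<open>A n\<close>; it leaves none when the distance
    is 0, which is treated with an arbitrary positive margin instead.\<close>
  have "infdist x T \<le> 2 * hausdorff_distance (A n) S + hausdorff_distance (A n) T" for n
  proof (cases "hausdorff_distance (A n) S = 0")
    case False
    have "0 \<le> infdist x (A n)" by (rule infdist_nonneg)
    also have *: "infdist x (A n) \<le> hausdorff_distance (A n) S"
      using infdist_le_hausdorff_distance[OF compact_imp_bounded[OF S(1)] A(1,2) x]
      by (simp add: hausdorff_distance_commute)
    finally have "infdist x (A n) < 2 * hausdorff_distance (A n) S" using * False by linarith
    then obtain a where a: "a \<in> A n" "dist x a < 2 * hausdorff_distance (A n) S"
      using A(2)[of n] unfolding infdist_def by (auto simp: cInf_less_iff)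
    have "infdist x T \<le> infdist a T + dist x a" by (rule infdist_triangle)
    also have "infdist a T \<le> hausdorff_distance (A n) T"
      by (rule infdist_le_hausdorff_distance[OF A(1) compact_imp_bounded[OF T(1)] T(2) a(1)])
    finally show ?thesis using a(2) by linarith
  next
    case True
    have "infdist x (A n) \<le> hausdorff_distance (A n) S"
      using infdist_le_hausdorff_distance[OF compact_imp_bounded[OF S(1)] A(1,2) x]
      by (simp add: hausdorff_distance_commute)
    then have 0: "infdist x (A n) = 0" using True infdist_nonneg[of x "A n"] by linarith
    have "infdist x T \<le> hausdorff_distance (A n) T + e" if "e > 0" for e
    proof -
      have "infdist x (A n) < e" using 0 that by simp
      then obtain a where a: "a \<in> A n" "dist x a < e"
        using A(2)[of n] unfolding infdist_def by (auto simp: cInf_less_iff)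
      have "infdist x T \<le> infdist a T + dist x a" by (rule infdist_triangle)
      also have "infdist a T \<le> hausdorff_distance (A n) T"
        by (rule infdist_le_hausdorff_distance[OF A(1) compact_imp_bounded[OF T(1)] T(2) a(1)])
      finally show ?thesis using a(2) by linarith
    qed
    then have "infdist x T \<le> hausdorff_distance (A n) T" by (rule field_le_epsilon)
    then show ?thesis using True by simp
  qed
  moreover have "(\<lambda>n. 2 * hausdorff_distance (A n) S + hausdorff_distance (A n) T) \<longlonglongrightarrow> 2 * 0 + 0"
    by (intro tendsto_intros S T)
  ultimately have "infdist x T \<le> 2 * 0 + 0"
    by (intro LIMSEQ_le_const) auto
  then have "infdist x T = 0" using infdist_nonneg[of x T] by linarith
  then show "x \<in> T"
    using in_closed_iff_infdist_zero[OF compact_imp_closed[OF T(1)] T(2)] by blast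
qed

lemma hausdorff_limit_eq:
  fixes A :: "nat \<Rightarrow> 'a::metric_space set"
  assumes "\<And>n. bounded (A n)" "\<And>n. A n \<noteq> {}" "is_hausdorff_limit A T"
  shows "hausdorff_limit A = T"
  unfolding hausdorff_limit_def
  using hausdorff_limit_subset[OF assms(1,2)] assms(3) by (intro the_equality antisym)

subsection \<open>The contracting plane and the expanding line\<close>

text \<open>The pointwise decrease becomes a uniform factor \<open>r\<close> because the ratio of
  the norms attains its maximum on the compact unit sphere of \<open>P\<close>. The rate per step is
  the cube root of \<open>r\<close>.\<close>

lemma iterated_contraction:
  fixes T :: "'a::euclidean_space \<Rightarrow> 'a"
  assumes T: "linear T" and P: "subspace P" and inv: "\<And>x. x \<in> P \<Longrightarrow> T x \<in> P"
    and contr: "\<And>x. x \<in> P \<Longrightarrow> x \<noteq> 0 \<Longrightarrow> infnorm ((T ^^ 3) x) < infnorm x"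
  obtains C \<rho> where "0 < C" "0 < \<rho>" "\<rho> < 1" "\<And>n x. x \<in> P \<Longrightarrow> norm ((T ^^ n) x) \<le> C * \<rho> ^ n * norm x"
proof -
  have lin: "linear (T ^^ n)" for n
  proof (induction n)
    case 0
    show ?case unfolding funpow.simps by (rule linear_id)
  next
    case (Suc n)
    show ?case unfolding funpow.simps by (rule linear_compose[OF Suc T])
  qed
  have invn: "(T ^^ n) x \<in> P" if "x \<in> P" for n x
    by (induction n) (simp_all add: that inv)
  obtain r where r: "0 < r" "r < 1" "\<And>x. x \<in> P \<Longrightarrow> infnorm ((T ^^ 3) x) \<le> r * infnorm x"
  proof (cases "P \<inter> sphere 0 1 = {}")
    case True
    have zero: "x = 0" if "x \<in> P" for x
    proof (rule ccontr)
      assume "x \<noteq> 0"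
      then have "x /\<^sub>R norm x \<in> P \<inter> sphere 0 1"
        using that P by (simp add: subspace_scale)
      then show False using True by blast
    qed
    have "infnorm ((T ^^ 3) x) \<le> 1 / 2 * infnorm x" if "x \<in> P" for x
      using zero[OF that] linear_0[OF lin[of 3]] by (simp add: infnorm_0 del: funpow.simps)
    then show ?thesis by (intro that[of "1/2"]) auto
  next
    case False
    let ?f = "\<lambda>x. infnorm ((T ^^ 3) x) / infnorm x"
    have "compact (P \<inter> sphere 0 1)"
      by (intro closed_Int_compact closed_subspace P) simp
    moreover have "continuous_on (P \<inter> sphere 0 1) ?f"
    proof (rule continuous_on_divide)
      show "continuous_on (P \<inter> sphere 0 1) (\<lambda>x. infnorm ((T ^^ 3) x))"
        by (intro continuous_on_infnorm linear_continuous_on lin[unfolded linear_conv_bounded_linear])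
      show "continuous_on (P \<inter> sphere 0 1) infnorm"
        by (rule continuous_on_infnorm[OF continuous_on_id])
      show "\<forall>x\<in>P \<inter> sphere 0 1. infnorm x \<noteq> 0" by (auto simp: infnorm_eq_0)
    qed
    ultimately have "\<exists>z\<in>P \<inter> sphere 0 1. \<forall>x\<in>P \<inter> sphere 0 1. ?f x \<le> ?f z"
      using False by (intro continuous_attains_sup)
    then obtain z where z: "z \<in> P \<inter> sphere 0 1" "\<And>x. x \<in> P \<inter> sphere 0 1 \<Longrightarrow> ?f x \<le> ?f z"
      by blast
    have "z \<noteq> 0" using z by auto
    then have "?f z < 1" using contr[of z] z by (simp add: infnorm_pos_lt)
    \<comment> \<open>The maximal ratio could be 0; raising it to at least 1/2 keeps the rate
      positive, so that one may divide by powers of it.\<close>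
    have *: "infnorm ((T ^^ 3) x) \<le> max (?f z) (1/2) * infnorm x" if "x \<in> P" for x
    proof (cases "x = 0")
      case True
      then show ?thesis by (simp add: linear_0[OF lin] infnorm_0)
    next
      case False
      have "x /\<^sub>R norm x \<in> P \<inter> sphere 0 1"
        using that P False by (simp add: subspace_scale)
      then have "?f (x /\<^sub>R norm x) \<le> ?f z" by (rule z)
      moreover have "?f (x /\<^sub>R norm x) = ?f x"
        using False by (simp add: linear_cmul[OF lin] infnorm_mul)
      ultimately have "?f x \<le> max (?f z) (1/2)" by linarith
      then show ?thesis using False by (simp add: infnorm_pos_lt divide_le_eq)
    qed
    show ?thesis by (rule that[OF _ _ *]) (use \<open>?f z < 1\<close> in auto)
  qed
  define \<rho> where "\<rho> = root 3 r"
  have \<rho>: "0 < \<rho>" "\<rho> < 1" "\<rho> ^ 3 = r" using r by (simp_all add: \<rho>_def)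
  have *: "infnorm ((T ^^ (3 * q)) x) \<le> \<rho> ^ (3 * q) * infnorm x" if "x \<in> P" for q x
  proof (induction q)
    case (Suc q)
    have "(T ^^ (3 * Suc q)) x = (T ^^ 3) ((T ^^ (3 * q)) x)"
      by (simp add: funpow_add[of 3 "3 * q", simplified] del: funpow.simps)
    then have "infnorm ((T ^^ (3 * Suc q)) x) \<le> r * infnorm ((T ^^ (3 * q)) x)"
      using r(3)[OF invn[OF that]] by simp
    also have "\<dots> \<le> r * (\<rho> ^ (3 * q) * infnorm x)"
      using Suc r(1) by simp
    also have "\<dots> = \<rho> ^ (3 * Suc q) * infnorm x" by (simp add: power_add \<rho>(3)[symmetric])
    finally show ?case .
  qed simp
  obtain B where B: "B > 0" "\<And>x. norm (T x) \<le> B * norm x"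
    using linear_bounded_pos[OF T] by blast
  have Bk: "norm ((T ^^ k) x) \<le> (max 1 B) ^ k * norm x" for k x
  proof (induction k)
    case (Suc k)
    have "norm ((T ^^ Suc k) x) \<le> B * norm ((T ^^ k) x)" using B(2) by simp
    also have "\<dots> \<le> max 1 B * (max 1 B ^ k * norm x)"
      by (rule mult_mono) (use Suc B in auto)
    finally show ?case by (simp add: mult.assoc)
  qed simp
  \<comment> \<open>The square of \<open>max 1 B\<close> pays for up to two leftover applications of
    \<open>T\<close>, the root for passing from the maximum norm to the Euclidean norm, and the
    division by \<open>\<rho>\<^sup>2\<close> for the exponent \<open>3 * (n div 3)\<close>, which
    may fall short of \<open>n\<close> by 2.\<close>
  let ?C = "(max 1 B)\<^sup>2 * sqrt (real DIM('a)) / \<rho>\<^sup>2"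
  have "norm ((T ^^ n) x) \<le> ?C * \<rho> ^ n * norm x" if "x \<in> P" for n x
  proof -
    let ?q = "n div 3" and ?k = "n mod 3"
    have n: "n = ?k + 3 * ?q" by simp
    have k: "?k \<le> 2" by (simp add: less_Suc_eq_le[symmetric])
    have "norm ((T ^^ n) x) = norm ((T ^^ ?k) ((T ^^ (3 * ?q)) x))"
      by (subst n, subst funpow_add) simp
    also have "\<dots> \<le> (max 1 B) ^ ?k * norm ((T ^^ (3 * ?q)) x)" by (rule Bk)
    also have "\<dots> \<le> (max 1 B)\<^sup>2 * (sqrt (real DIM('a)) * (\<rho> ^ (3 * ?q) * norm x))"
    proof (rule mult_mono)
      show "(max 1 B) ^ ?k \<le> (max 1 B)\<^sup>2" by (rule power_increasing[OF k]) simp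
      have "norm ((T ^^ (3 * ?q)) x) \<le> sqrt (real DIM('a)) * infnorm ((T ^^ (3 * ?q)) x)"
        by (rule norm_le_infnorm)
      also have "\<dots> \<le> sqrt (real DIM('a)) * (\<rho> ^ (3 * ?q) * infnorm x)"
        using *[OF that] by (intro mult_left_mono) auto
      also have "\<dots> \<le> sqrt (real DIM('a)) * (\<rho> ^ (3 * ?q) * norm x)"
        using \<rho> by (intro mult_left_mono infnorm_le_norm) auto
      finally show "norm ((T ^^ (3 * ?q)) x) \<le> sqrt (real DIM('a)) * (\<rho> ^ (3 * ?q) * norm x)" .
    qed auto
    also have "\<rho> ^ (3 * ?q) \<le> \<rho> ^ n / \<rho>\<^sup>2"
    proof -
      have "\<rho> ^ (3 * ?q) * \<rho>\<^sup>2 \<le> \<rho> ^ (3 * ?q) * \<rho> ^ ?k"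
        using k \<rho> by (intro mult_left_mono power_decreasing) auto
      also have "\<dots> = \<rho> ^ n" unfolding power_add[symmetric] by simp
      finally show ?thesis using \<rho> by (simp add: pos_le_divide_eq)
    qed
    finally show ?thesis by (simp add: mult_left_mono mult_right_mono mult_ac divide_simps)
  qed
  then show ?thesis using that[of ?C \<rho>] B \<rho> by simp
qed

section \<open>Real and complex incidence matrices and the cubic equation of the eigenvalues\<close>

lemma complex_incidence_matrix_nth:
  "complex_incidence_matrix \<sigma> $ i $ j = complex_of_real (real_incidence_matrix \<sigma> $ i $ j)"
  by (simp add: complex_incidence_matrix_def real_incidence_matrix_nth)

definition real_vec :: "int^3 \<Rightarrow> real^3" where
  "real_vec x = (\<chi> i. real_of_int (x $ i))"

lemma real_vec_mult: "real_vec (incidence_matrix \<sigma> *v x) = real_incidence_matrix \<sigma> *v real_vec x"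
  by (simp add: real_vec_def vec_eq_iff matrix_vector_mult_def real_incidence_matrix_nth)

lemma real_vec_add: "real_vec (x + y) = real_vec x + real_vec y"
  by (simp add: real_vec_def vec_eq_iff)

lemma real_incidence_matrix_inj:
  assumes "invertible (incidence_matrix \<sigma>)" "real_incidence_matrix \<sigma> *v x = 0"
  shows "x = 0"
proof -
  obtain B where B: "B ** incidence_matrix \<sigma> = mat 1" using assms(1) unfolding invertible_def by blast
  have "map_matrix real_of_int B ** real_incidence_matrix \<sigma> = map_matrix real_of_int (B ** incidence_matrix \<sigma>)"
    by (simp add: vec_eq_iff matrix_matrix_mult_def real_incidence_matrix_nth)
  also have "\<dots> = mat 1" by (simp add: B vec_eq_iff mat_def)
  finally have "map_matrix real_of_int B *v (real_incidence_matrix \<sigma> *v x) = x"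
    by (simp add: matrix_vector_mul_assoc)
  then show ?thesis using assms(2) by simp
qed

lemma cayley_hamilton_3:
  fixes A :: "'a::comm_ring_1^3^3"
  defines "t \<equiv> A$1$1 + A$2$2 + A$3$3"
    and "s \<equiv> A$1$1 * A$2$2 - A$1$2 * A$2$1 + A$1$1 * A$3$3 - A$1$3 * A$3$1 + A$2$2 * A$3$3 - A$2$3 * A$3$2"
    and "d \<equiv> A$1$1 * A$2$2 * A$3$3 + A$1$2 * A$2$3 * A$3$1 + A$1$3 * A$2$1 * A$3$2
      - A$1$1 * A$2$3 * A$3$2 - A$1$2 * A$2$1 * A$3$3 - A$1$3 * A$2$2 * A$3$1"
  shows "A *v (A *v (A *v x)) = t *s (A *v (A *v x)) - s *s (A *v x) + d *s x"
  unfolding t_def s_def d_def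
  by (simp add: vec_eq_iff forall_3 matrix_vector_mult_def sum_3 algebra_simps)

text \<open>The rational root theorem for monic integer cubics: the denominator divides the cube of
  the coprime numerator.\<close>

lemma rational_cubic_root_Ints:
  fixes m :: real and t s d :: int
  assumes "m \<in> \<rat>" "m ^ 3 = t * m\<^sup>2 - s * m + d"
  shows "m \<in> \<int>"
proof -
  obtain a b :: int where ab: "b > 0" "coprime a b" "m = a / b"
    using assms(1) by (rule Rats_cases')
  have "real_of_int a ^ 3 = b * (t * a\<^sup>2 - s * a * b + d * b\<^sup>2)"
    using assms(2) ab(1) unfolding ab(3) by (simp add: field_simps power2_eq_square power3_eq_cube)
  then have "real_of_int (a ^ 3) = real_of_int (b * (t * a\<^sup>2 - s * a * b + d * b\<^sup>2))" by simp
  then have "a ^ 3 = b * (t * a\<^sup>2 - s * a * b + d * b\<^sup>2)" unfolding of_int_eq_iff .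
  then have "b dvd a ^ 3" by simp
  moreover have "coprime (a ^ 3) b" using ab(2) by simp
  ultimately have "is_unit b" using coprime_common_divisor[of "a ^ 3" b b] by simp
  then have "b = 1" using ab(1) by simp
  then show ?thesis using ab(3) by simp
qed

context contracting_incidence
begin

abbreviation M :: "real^3^3" where "M \<equiv> real_incidence_matrix \<sigma>"

lemma inner_mult: "l \<bullet> (M *v x) = \<kappa> * (l \<bullet> x)"
  using dot_lmul_matrix[of l M x] by (simp add: left_eigenvector)

lemma linear_M: "linear ((*v) M)"
  by simp

lemma linear_funpow: "linear ((*v) M ^^ n)"
proof (induction n)
  case 0
  show ?case unfolding funpow.simps by (rule linear_id)
next
  case (Suc n)
  show ?case unfolding funpow.simps by (rule linear_compose[OF Suc linear_M])
qed

lemma geometric_decay: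
  obtains C \<rho> where "0 < C" "0 < \<rho>" "\<rho> < 1"
    "\<And>n x. l \<bullet> x = 0 \<Longrightarrow> norm (((*v) M ^^ n) x) \<le> C * \<rho> ^ n * norm x"
proof -
  have P: "subspace {x. l \<bullet> x = 0}"
    by (rule subspace_hyperplane)
  show ?thesis
    by (rule iterated_contraction[OF linear_M P]) (use contracting that in \<open>auto simp: inner_mult\<close>)
qed

text \<open>The tool for proving vector identities below: a difference that lies in the plane and is
  an eigenvector with \<open>\<bar>r\<bar> \<ge> 1\<close> must vanish.\<close>

lemma eigenvector_plane_zero:
  assumes "l \<bullet> x = 0" "M *v x = r *\<^sub>R x" "\<bar>r\<bar> \<ge> 1"
  shows "x = 0"
proof (rule ccontr)
  assume "x \<noteq> 0"
  have "((*v) M ^^ 3) x = r ^ 3 *\<^sub>R x"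
    using assms(2) by (simp add: numeral_3_eq_3 matrix_vector_mult_scaleR)
  then have "\<bar>r\<bar> ^ 3 * infnorm x < infnorm x"
    using contracting[OF assms(1) \<open>x \<noteq> 0\<close>] by (simp add: infnorm_mul power_abs)
  moreover have "1 * infnorm x \<le> \<bar>r\<bar> ^ 3 * infnorm x"
    by (intro mult_right_mono one_le_power assms infnorm_pos_le)
  ultimately show False by simp
qed

text \<open>The left eigenvector makes \<open>M - \<kappa>\<close> singular, so it has a kernel
  vector; that vector cannot lie in the contracted plane since \<kappa> exceeds 1.\<close>

lemma right_eigenvector:
  obtains v where "M *v v = \<kappa> *\<^sub>R v" "l \<bullet> v \<noteq> 0"
proof -
  have "\<exists>v. (M - \<kappa> *\<^sub>R mat 1) *v v = 0 \<and> v \<noteq> 0"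
  proof (rule ccontr)
    assume "\<nexists>v. (M - \<kappa> *\<^sub>R mat 1) *v v = 0 \<and> v \<noteq> 0"
    then have "\<exists>B. B ** (M - \<kappa> *\<^sub>R mat 1) = mat 1"
      unfolding matrix_left_invertible_ker by blast
    then obtain B where B: "(M - \<kappa> *\<^sub>R mat 1) ** B = mat 1"
      unfolding matrix_left_right_inverse by blast
    have "l v* (M - \<kappa> *\<^sub>R mat 1) = 0"
      by (simp add: vector_matrix_mult_diff_rdistrib left_eigenvector vector_scaleR_matrix_ac)
    then have "l v* (M - \<kappa> *\<^sub>R mat 1) v* B = 0" by simp
    then show False using nonzero by (simp add: vector_matrix_mul_assoc B)
  qed
  then obtain v where v: "M *v v = \<kappa> *\<^sub>R v" "v \<noteq> 0"
    by (auto simp: matrix_vector_mult_diff_rdistrib scaleR_matrix_vector_assoc[symmetric])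
  have "l \<bullet> v \<noteq> 0" using eigenvector_plane_zero[OF _ v(1)] v(2) expanding by auto
  then show ?thesis using that v by blast
qed

lemma expanding_line_eq:
  assumes v: "M *v v = \<kappa> *\<^sub>R v" "l \<bullet> v \<noteq> 0"
  shows "expanding_line \<sigma> = span {v}"
proof -
  have "w \<in> span {v}" if w: "M *v w = r *\<^sub>R w" "\<bar>r\<bar> > 1" for w r
  proof -
    \<comment> \<open>Subtracting this multiple of \<open>v\<close> puts \<open>w\<close> into the
      plane. The difference is still an eigenvector for \<open>r\<close>: either the multiple is
      zero, or comparison under \<open>l\<close> gives \<open>r = \<kappa>\<close>.\<close>
    let ?c = "(l \<bullet> w) / (l \<bullet> v)"
    have l: "\<kappa> * (l \<bullet> w) = r * (l \<bullet> w)"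
      using inner_mult[of w] unfolding w(1) inner_scaleR_right by (rule sym)
    have "w - ?c *\<^sub>R v = 0"
    proof (rule eigenvector_plane_zero)
      show "l \<bullet> (w - ?c *\<^sub>R v) = 0" using v by (simp add: inner_diff_right)
      show "M *v (w - ?c *\<^sub>R v) = r *\<^sub>R (w - ?c *\<^sub>R v)"
      proof (cases "l \<bullet> w = 0")
        case False
        then have "r = \<kappa>" using l by simp
        then show ?thesis
          by (simp add: matrix_vector_mult_diff_distrib matrix_vector_mult_scaleR w v scaleR_diff_right)
      qed (simp add: w)
      show "\<bar>r\<bar> \<ge> 1" using w by simp
    qed
    then show ?thesis by (metis right_minus_eq singletonI span_base span_scale)
  qed
  moreover have "v \<in> {w. \<exists>r. \<bar>r\<bar> > 1 \<and> M *v w = r *\<^sub>R w}"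
    using v expanding by (auto intro!: exI[of _ \<kappa>])
  ultimately show ?thesis unfolding expanding_line_def
    by (intro antisym span_minimal span_mono subspace_span) auto
qed

lemma cayley_hamilton_int:
  obtains t s d :: int where "\<And>x. M *v (M *v (M *v x)) = of_int t *\<^sub>R (M *v (M *v x)) - of_int s *\<^sub>R (M *v x) + of_int d *\<^sub>R x"
proof -
  let ?A = "incidence_matrix \<sigma>"
  let ?t = "?A$1$1 + ?A$2$2 + ?A$3$3"
  let ?s = "?A$1$1 * ?A$2$2 - ?A$1$2 * ?A$2$1 + ?A$1$1 * ?A$3$3 - ?A$1$3 * ?A$3$1 + ?A$2$2 * ?A$3$3 - ?A$2$3 * ?A$3$2"
  let ?d = "?A$1$1 * ?A$2$2 * ?A$3$3 + ?A$1$2 * ?A$2$3 * ?A$3$1 + ?A$1$3 * ?A$2$1 * ?A$3$2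
      - ?A$1$1 * ?A$2$3 * ?A$3$2 - ?A$1$2 * ?A$2$1 * ?A$3$3 - ?A$1$3 * ?A$2$2 * ?A$3$1"
  show ?thesis
    by (rule that[of ?t ?s ?d], subst cayley_hamilton_3)
      (simp add: real_incidence_matrix_nth scalar_mult_eq_scaleR)
qed

text \<open>The discriminant matters because \<open>contracting_plane\<close> is spanned by genuine
  eigenvectors: with a Jordan block their span would be too small.\<close>

lemma plane_quadratic:
  obtains p q where "\<And>x. l \<bullet> x = 0 \<Longrightarrow> M *v (M *v x) = p *\<^sub>R (M *v x) - q *\<^sub>R x" "p\<^sup>2 \<noteq> 4 * q"
proof -
  obtain t s d :: int where CH: "\<And>x. M *v (M *v (M *v x)) = of_int t *\<^sub>R (M *v (M *v x)) - of_int s *\<^sub>R (M *v x) + of_int d *\<^sub>R x"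
    by (rule cayley_hamilton_int) blast
  have root: "r ^ 3 = of_int t * r\<^sup>2 - of_int s * r + of_int d" if "M *v v = r *\<^sub>R v" "v \<noteq> 0" for v r
  proof -
    have "(r ^ 3) *\<^sub>R v = (of_int t * r\<^sup>2 - of_int s * r + of_int d) *\<^sub>R v"
      using CH[of v] by (simp add: that matrix_vector_mult_scaleR power3_eq_cube power2_eq_square
          scaleR_add_left scaleR_diff_left mult.assoc)
    then show ?thesis using that(2) by simp
  qed
  obtain v where v: "M *v v = \<kappa> *\<^sub>R v" "l \<bullet> v \<noteq> 0" by (rule right_eigenvector)
  have \<kappa>: "\<kappa> ^ 3 = of_int t * \<kappa>\<^sup>2 - of_int s * \<kappa> + of_int d"
    using v by (intro root[of v]) auto
  \<comment> \<open>Division of \<open>X^3 - t X^2 + s X - d\<close> by \<open>X - \<kappa>\<close>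
    leaves the quotient \<open>X^2 - p X + q\<close>; the vanishing remainder is the equation for
    \<open>d\<close> below.\<close>
  define p where "p = of_int t - \<kappa>"
  define q where "q = of_int s - \<kappa> * p"
  have t: "of_int t = p + \<kappa>" and s: "of_int s = q + \<kappa> * p" by (simp_all add: p_def q_def)
  have d: "of_int d = \<kappa> * q"
    using \<kappa> unfolding s t by (simp add: algebra_simps power2_eq_square power3_eq_cube)
  have quad: "M *v (M *v x) = p *\<^sub>R (M *v x) - q *\<^sub>R x" if "l \<bullet> x = 0" for x
  proof -
    let ?u = "M *v (M *v x) - p *\<^sub>R (M *v x) + q *\<^sub>R x"
    have "?u = 0"
    proof (rule eigenvector_plane_zero)
      show "l \<bullet> ?u = 0" using that by (simp add: inner_diff_right inner_add_right inner_mult)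
      show "M *v ?u = \<kappa> *\<^sub>R ?u"
        by (simp add: matrix_vector_mult_diff_distrib matrix_vector_right_distrib matrix_vector_mult_scaleR CH t s d
            algebra_simps)
    qed (use expanding in simp)
    then show ?thesis by (simp add: algebra_simps)
  qed
  moreover have "p\<^sup>2 \<noteq> 4 * q"
  proof
    assume pq: "p\<^sup>2 = 4 * q"
    define m where "m = p / 2"
    have pm: "p = 2 * m" "q = m\<^sup>2" using pq by (simp_all add: m_def power_divide)
    obtain x where x: "x \<noteq> 0" "l \<bullet> x = 0"
    proof (cases "l $ 1 = 0 \<and> l $ 2 = 0")
      case True
      then show ?thesis using that[of "vector [1, 0, 0]"] by (simp add: inner_vec_def sum_3 vec_eq_iff forall_3)
    next
      case False
      then show ?thesis
        by (intro that[of "vector [l $ 2, - l $ 1, 0]"]) (auto simp: inner_vec_def sum_3 vec_eq_iff forall_3)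
    qed
    \<comment> \<open>With a double root, \<open>(M - m)^2\<close> vanishes on the plane, so either
      \<open>x\<close> or \<open>(M - m) x\<close> is a real eigenvector for
      \<open>m\<close>.\<close>
    obtain w where w: "w \<noteq> 0" "l \<bullet> w = 0" "M *v w = m *\<^sub>R w"
    proof (cases "M *v x = m *\<^sub>R x")
      case True
      then show ?thesis using x that by blast
    next
      case False
      have "M *v (M *v x - m *\<^sub>R x) = m *\<^sub>R (M *v x - m *\<^sub>R x)"
        by (simp add: matrix_vector_mult_diff_distrib matrix_vector_mult_scaleR quad[OF x(2)] pm
            algebra_simps power2_eq_square flip: scaleR_add_left)
      then show ?thesis using x False by (intro that[of "M *v x - m *\<^sub>R x"]) (auto simp: inner_diff_right inner_mult)
    qed
    have m1: "\<bar>m\<bar> < 1" using eigenvector_plane_zero[OF w(2,3)] w(1) by linarith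
    \<comment> \<open>For a cubic with roots \<open>m, m, \<kappa>\<close>, both
      \<open>t^2 - 3 s = (\<kappa> - m)^2\<close> and
      \<open>t s - 9 d = 2 m (\<kappa> - m)^2\<close> are integers, which exhibits \<open>m\<close>
      as a quotient of integers.\<close>
    have "of_int (t\<^sup>2 - 3 * s) = (\<kappa> - m)\<^sup>2"
      by (simp add: t s pm power2_eq_square algebra_simps)
    moreover have "m * (2 * of_int (t\<^sup>2 - 3 * s)) = of_int (t * s - 9 * d)"
      by (simp add: t s d pm power2_eq_square algebra_simps)
    moreover have "(\<kappa> - m)\<^sup>2 \<noteq> 0" using m1 expanding by auto
    ultimately have "m = of_int (t * s - 9 * d) / of_int (2 * (t\<^sup>2 - 3 * s))"
      by (simp add: field_simps)
    then have "m \<in> \<rat>" by simp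
    then have "m \<in> \<int>" using rational_cubic_root_Ints root[OF w(3,1)] by blast
    then have "m = 0" using m1 by (auto elim: Ints_cases)
    then show False using w real_incidence_matrix_inj[OF invertible] by simp
  qed
  ultimately show ?thesis using that by blast
qed

section \<open>Complexification and the contracting plane\<close>

definition cvec :: "real^3 \<Rightarrow> complex^3" where
  "cvec x = (\<chi> i. complex_of_real (x $ i))"

text \<open>The complex-linear extension of the inner product with \<open>l\<close>; its kernel
  complexifies the plane.\<close>

definition cform :: "complex^3 \<Rightarrow> complex" where
  "cform w = (\<Sum>i\<in>UNIV. complex_of_real (l $ i) * w $ i)"

abbreviation Mc :: "complex^3^3" where "Mc \<equiv> complex_incidence_matrix \<sigma>"

lemma cform_cvec: "cform (cvec x) = complex_of_real (l \<bullet> x)"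
  by (simp add: cform_def cvec_def inner_vec_def)

lemma Mc_cvec: "Mc *v cvec x = cvec (M *v x)"
  by (simp add: cvec_def vec_eq_iff matrix_vector_mult_def complex_incidence_matrix_nth)

lemma cform_Re_Im:
  "l \<bullet> (\<chi> i. Re (w $ i)) = Re (cform w)" "l \<bullet> (\<chi> i. Im (w $ i)) = Im (cform w)"
  by (simp_all add: cform_def inner_vec_def)

lemma Mc_Re_Im:
  "M *v (\<chi> i. Re (w $ i)) = (\<chi> i. Re ((Mc *v w) $ i))" "M *v (\<chi> i. Im (w $ i)) = (\<chi> i. Im ((Mc *v w) $ i))"
  by (simp_all add: vec_eq_iff matrix_vector_mult_def complex_incidence_matrix_nth)

lemma cform_mult: "cform (Mc *v w) = complex_of_real \<kappa> * cform w"
proof -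
  have "Re (cform (Mc *v w)) = \<kappa> * Re (cform w)" "Im (cform (Mc *v w)) = \<kappa> * Im (cform w)"
    unfolding cform_Re_Im[symmetric] Mc_Re_Im[symmetric] by (simp_all add: inner_mult)
  then show ?thesis by (simp add: complex_eq_iff)
qed

text \<open>A complex eigenvalue mixes real and imaginary parts, so the maximum norm argument for
  real eigenvectors does not carry over. Instead both parts of \<open>z^n w\<close> decay
  geometrically, while \<open>cmod z \<ge> 1\<close> keeps each entry at least as large as in
  \<open>w\<close>.\<close>

lemma complex_eigenvector_plane_zero:
  assumes "cform w = 0" "Mc *v w = z *s w" "cmod z \<ge> 1"
  shows "w = 0"
proof -
  obtain C \<rho> where C: "0 < C" "0 < \<rho>" "\<rho> < 1"
    "\<And>n x. l \<bullet> x = 0 \<Longrightarrow> norm (((*v) M ^^ n) x) \<le> C * \<rho> ^ n * norm x"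
    by (rule geometric_decay) blast
  let ?R = "\<lambda>w::complex^3. (\<chi> i. Re (w $ i)) :: real^3" and ?I = "\<lambda>w::complex^3. (\<chi> i. Im (w $ i)) :: real^3"
  have pow: "((*v) M ^^ n) (?R w) = ?R (z ^ n *s w)" "((*v) M ^^ n) (?I w) = ?I (z ^ n *s w)" for n
    by (induction n) (simp_all add: Mc_Re_Im matrix_vector_mult_scaleR vector_scalar_commute assms(2) mult_ac
        del: vector_smult_component)
  have bound: "cmod (w $ i) \<le> C * (norm (?R w) + norm (?I w)) * \<rho> ^ n" for i n
  proof -
    have "1 * cmod (w $ i) \<le> cmod z ^ n * cmod (w $ i)"
      by (intro mult_right_mono one_le_power assms) simp
    also have "\<dots> = cmod ((z ^ n *s w) $ i)" by (simp add: norm_mult norm_power)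
    also have "\<dots> \<le> \<bar>Re ((z ^ n *s w) $ i)\<bar> + \<bar>Im ((z ^ n *s w) $ i)\<bar>" by (rule cmod_le)
    also have "\<dots> \<le> norm (?R (z ^ n *s w)) + norm (?I (z ^ n *s w))"
      using component_le_norm_cart[of "?R (z ^ n *s w)" i] component_le_norm_cart[of "?I (z ^ n *s w)" i] by simp
    also have "\<dots> \<le> C * \<rho> ^ n * norm (?R w) + C * \<rho> ^ n * norm (?I w)"
      unfolding pow[symmetric] by (intro add_mono C) (simp_all add: cform_Re_Im assms(1))
    finally show ?thesis by (simp add: algebra_simps)
  qed
  have "w $ i = 0" for i
  proof -
    have "(\<lambda>n. C * (norm (?R w) + norm (?I w)) * \<rho> ^ n) \<longlonglongrightarrow> C * (norm (?R w) + norm (?I w)) * 0"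
      using C by (intro tendsto_intros LIMSEQ_power_zero) simp
    then have "cmod (w $ i) \<le> C * (norm (?R w) + norm (?I w)) * 0"
      by (rule LIMSEQ_le_const) (use bound in blast)
    then show ?thesis by simp
  qed
  then show ?thesis by (simp add: vec_eq_iff)
qed

lemma contracting_plane_eq: "contracting_plane \<sigma> = {x. l \<bullet> x = 0}"
proof -
  let ?E = "{w. \<exists>z. cmod z < 1 \<and> Mc *v w = z *s w}"
  have "l \<bullet> x = 0" if "cvec x \<in> vec.span ?E" for x
  proof -
    have "vec.subspace {w. cform w = 0}"
      by (rule vec.subspaceI) (simp_all add: cform_def algebra_simps sum.distrib flip: sum_distrib_left)
    moreover have "?E \<subseteq> {w. cform w = 0}"
    proof clarify
      fix w z assume "cmod z < 1" "Mc *v w = z *s w"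
      then have "complex_of_real \<kappa> * cform w = z * cform w"
        using cform_mult[of w] by (simp add: cform_def sum_distrib_left mult_ac)
      moreover have "complex_of_real \<kappa> \<noteq> z" using \<open>cmod z < 1\<close> expanding by auto
      ultimately show "cform w = 0" by simp
    qed
    ultimately have "cform (cvec x) = 0" using vec.span_minimal that by blast
    then show ?thesis by (simp add: cform_cvec)
  qed
  moreover have "cvec x \<in> vec.span ?E" if x: "l \<bullet> x = 0" for x
  proof -
    obtain p q where pq: "\<And>x. l \<bullet> x = 0 \<Longrightarrow> M *v (M *v x) = p *\<^sub>R (M *v x) - q *\<^sub>R x" "p\<^sup>2 \<noteq> 4 * q"
      by (rule plane_quadratic) blast
    define \<Delta> where "\<Delta> = csqrt (complex_of_real (p\<^sup>2 - 4 * q))"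
    have "p\<^sup>2 - 4 * q \<noteq> 0" using pq(2) by simp
    then have \<Delta>: "\<Delta>\<^sup>2 = complex_of_real (p\<^sup>2 - 4 * q)" "\<Delta> \<noteq> 0"
      unfolding \<Delta>_def power2_csqrt csqrt_eq_0 of_real_eq_0_iff by simp_all
    define \<mu> where "\<mu> = (complex_of_real p + \<Delta>) / 2"
    define \<nu> where "\<nu> = (complex_of_real p - \<Delta>) / 2"
    have p: "complex_of_real p = \<mu> + \<nu>" by (simp add: \<mu>_def \<nu>_def field_simps)
    have q: "complex_of_real q = \<mu> * \<nu>"
      using \<Delta>(1) by (simp add: \<mu>_def \<nu>_def field_simps power2_eq_square)
    have ne: "\<mu> - \<nu> \<noteq> 0" using \<Delta>(2) by (simp add: \<mu>_def \<nu>_def field_simps)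
    let ?x = "cvec x"
    have MM: "Mc *v (Mc *v ?x) = (\<mu> + \<nu>) *s (Mc *v ?x) - (\<mu> * \<nu>) *s ?x"
      unfolding Mc_cvec pq(1)[OF x] p[symmetric] q[symmetric] by (simp add: cvec_def vec_eq_iff)
    \<comment> \<open>On the plane, \<open>(M - a)(M - b)\<close> vanishes whenever \<open>a\<close>
      and \<open>b\<close> are the two roots. Leaving their order open lets the statement serve for
      both eigenvectors, whose difference is \<open>(\<mu> - \<nu>) x\<close>.\<close>
    have eig: "Mc *v ?x - b *s ?x \<in> ?E" if "a + b = \<mu> + \<nu>" "a * b = \<mu> * \<nu>" for a b
    proof -
      let ?w = "Mc *v ?x - b *s ?x"
      have e: "Mc *v ?w = a *s ?w"
        unfolding matrix_vector_mult_diff_distrib vector_scalar_commute MM that[symmetric]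
        by (simp add: vec_eq_iff algebra_simps)
      have "cform ?w = cform (Mc *v ?x) - b * cform ?x"
        by (simp add: cform_def algebra_simps sum_subtractf sum_distrib_left)
      then have "cform ?w = 0" by (simp add: cform_mult cform_cvec x)
      then have "cmod a < 1 \<or> ?w = 0" using complex_eigenvector_plane_zero[OF _ e] by force
      then show ?thesis
      proof
        assume "?w = 0"
        then show ?thesis by (auto intro!: exI[of _ 0])
      qed (use e in auto)
    qed
    have "(Mc *v ?x - \<nu> *s ?x) - (Mc *v ?x - \<mu> *s ?x) = (\<mu> - \<nu>) *s ?x"
      by (simp add: vec_eq_iff algebra_simps)
    then have "?x = inverse (\<mu> - \<nu>) *s ((Mc *v ?x - \<nu> *s ?x) - (Mc *v ?x - \<mu> *s ?x))"
      using ne by (simp only: vector_smult_assoc left_inverse vector_smult_lid not_False_eq_True)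
    also have "\<dots> \<in> vec.span ?E"
      by (intro vec.span_scale vec.span_diff vec.span_base eig) (auto simp: mult.commute)
    finally show ?thesis .
  qed
  ultimately show ?thesis unfolding contracting_plane_def cvec_def by blast
qed

lemma proj_contracting_eq:
  assumes v: "M *v v = \<kappa> *\<^sub>R v" "l \<bullet> v \<noteq> 0"
  shows "proj_contracting \<sigma> x = x - ((l \<bullet> x) / (l \<bullet> v)) *\<^sub>R v"
  unfolding proj_contracting_def contracting_plane_eq expanding_line_eq[OF v]
proof (rule the_equality)
  show "x - ((l \<bullet> x) / (l \<bullet> v)) *\<^sub>R v \<in> {x. l \<bullet> x = 0} \<and> x - (x - ((l \<bullet> x) / (l \<bullet> v)) *\<^sub>R v) \<in> span {v}"
    using v by (simp add: inner_diff_right span_scale span_base)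
next
  fix y assume y: "y \<in> {x. l \<bullet> x = 0} \<and> x - y \<in> span {v}"
  then obtain c where c: "x - y = c *\<^sub>R v" by (auto simp: span_singleton)
  have "l \<bullet> x = l \<bullet> (x - y)" using y by (simp add: inner_diff_right)
  also have "\<dots> = c * (l \<bullet> v)" unfolding c by simp
  finally show "y = x - ((l \<bullet> x) / (l \<bullet> v)) *\<^sub>R v" using c v by (simp add: algebra_simps)
qed

lemma linear_proj: "linear (proj_contracting \<sigma>)"
  and inner_proj: "l \<bullet> proj_contracting \<sigma> x = 0"
  and proj_mult: "proj_contracting \<sigma> (M *v x) = M *v proj_contracting \<sigma> x"
proof -
  obtain v where v: "M *v v = \<kappa> *\<^sub>R v" "l \<bullet> v \<noteq> 0" by (rule right_eigenvector)
  note eq = proj_contracting_eq[OF v]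
  show "linear (proj_contracting \<sigma>)"
    by (rule linearI) (simp_all add: eq algebra_simps add_divide_distrib)
  show "l \<bullet> proj_contracting \<sigma> x = 0" using v by (simp add: eq inner_diff_right)
  show "proj_contracting \<sigma> (M *v x) = M *v proj_contracting \<sigma> x"
    by (simp add: eq inner_mult matrix_vector_mult_diff_distrib matrix_vector_mult_scaleR v)
qed

section \<open>Base points of faces and nested unions of balls\<close>

definition center :: "nat \<Rightarrow> face \<Rightarrow> real^3" where
  "center n f = ((*v) M ^^ n) (proj_contracting \<sigma> (real_vec (fst f)))"

text \<open>Since \<open>M y = x + P(s)\<close>, the factor \<open>M\<close> gained on passing to
  level \<open>n + 1\<close> cancels the inverse matrix in the dual substitution. Child and parent
  thus differ by \<open>M^n\<close> applied to one of finitely many projected suffix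
  vectors.\<close>

lemma center_child:
  assumes "(y, j) \<in> E1_star \<sigma> {(x, i)}"
  obtains p s where "\<sigma> j = p @ i # s"
    "center (Suc n) (y, j) = center n (x, i) + ((*v) M ^^ n) (proj_contracting \<sigma> (real_vec (abelianization s)))"
proof -
  obtain p s where s: "\<sigma> j = p @ i # s" "incidence_matrix \<sigma> *v y = x + abelianization s"
    using assms by (auto simp: E1_star_iff[OF invertible])
  have "center (Suc n) (y, j) = ((*v) M ^^ n) (proj_contracting \<sigma> (real_vec (incidence_matrix \<sigma> *v y)))"
    by (simp add: center_def funpow_swap1 real_vec_mult proj_mult)
  also have "\<dots> = center n (x, i) + ((*v) M ^^ n) (proj_contracting \<sigma> (real_vec (abelianization s)))"
    by (simp add: s(2) real_vec_add linear_add[OF linear_proj] linear_add[OF linear_funpow] center_def)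
  finally show ?thesis using that s(1) by blast
qed

lemma finite_E1_star_funpow: "finite F \<Longrightarrow> finite ((E1_star \<sigma> ^^ n) F)"
  by (induction n) (auto intro: finite_E1_star)

lemma E1_star_funpow_nonempty: "F \<noteq> {} \<Longrightarrow> (E1_star \<sigma> ^^ n) F \<noteq> {}"
proof (induction n)
  case (Suc n)
  then obtain f where "f \<in> (E1_star \<sigma> ^^ n) F" by auto
  then show ?case using E1_star_nonempty[OF invertible, of f] E1_star_mono[of "{f}" "(E1_star \<sigma> ^^ n) F" \<sigma>] by auto
qed simp

lemma center_in_rauzy_approx:
  assumes "f \<in> (E1_star \<sigma> ^^ n) F"
  shows "center n f \<in> rauzy_approx \<sigma> F n"
proof -
  obtain x i where f: "f = (x, i)" by fastforce
  have "\<exists>j k. {i, j, k} = (UNIV :: 3 set)"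
    using exhaust_3[of i] by (auto simp: UNIV_3)
  then obtain j k where "{i, j, k} = UNIV" by blast
  then have "real_vec x \<in> face_set f"
    unfolding f face_set_def real_vec_def prod.case mem_Collect_eq
    by (intro exI[of _ "0::real"] exI[of _ j] exI[of _ k]) simp
  then show ?thesis unfolding rauzy_approx_def center_def using assms by (force simp: f)
qed

lemma rauzy_approx_near_center:
  assumes "a \<in> rauzy_approx \<sigma> F n"
  obtains f v where "f \<in> (E1_star \<sigma> ^^ n) F" "norm v \<le> 2"
    "a = center n f + ((*v) M ^^ n) (proj_contracting \<sigma> v)"
proof -
  obtain f x where f: "f \<in> (E1_star \<sigma> ^^ n) F" "x \<in> face_set f" "a = ((*v) M ^^ n) (proj_contracting \<sigma> x)"
    using assms unfolding rauzy_approx_def by blast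
  obtain s t j k where x: "x = real_vec (fst f) + (s *\<^sub>R axis j 1 + t *\<^sub>R axis k 1)" "s \<in> {0..1}" "t \<in> {0..1}"
    using f(2) unfolding face_set_def real_vec_def by (cases f) (auto simp: add.assoc)
  have "norm (s *\<^sub>R axis j 1 + t *\<^sub>R axis k 1 :: real^3) \<le> \<bar>s\<bar> + \<bar>t\<bar>"
    by (rule order.trans[OF norm_triangle_ineq]) simp
  then have "norm (s *\<^sub>R axis j 1 + t *\<^sub>R axis k 1 :: real^3) \<le> 2" using x by auto
  then show ?thesis
    by (rule that[OF f(1)]) (simp add: f(3) x(1) center_def linear_add[OF linear_proj] linear_add[OF linear_funpow])
qed

lemma connected_hausdorff_limit_rauzy_approx:
  assumes F: "finite F" "F \<noteq> {}" and L: "finite L" "\<And>Q. Q \<in> L \<Longrightarrow> finite Q"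
    and linked: "\<And>n. linked L ((E1_star \<sigma> ^^ n) F)"
  shows "connected (hausdorff_limit (rauzy_approx \<sigma> F))"
proof -
  let ?G = "\<lambda>n. (E1_star \<sigma> ^^ n) F" and ?\<pi> = "proj_contracting \<sigma>" and ?A = "rauzy_approx \<sigma> F"
  obtain C \<rho> where C: "0 < C" "0 < \<rho>" "\<rho> < 1"
    and dec: "\<And>n x. l \<bullet> x = 0 \<Longrightarrow> norm (((*v) M ^^ n) x) \<le> C * \<rho> ^ n * norm x"
    by (rule geometric_decay) blast
  have decay: "norm (((*v) M ^^ n) (?\<pi> v)) \<le> C * c * \<rho> ^ n" if "norm (?\<pi> v) \<le> c" for n v c
  proof -
    have "norm (((*v) M ^^ n) (?\<pi> v)) \<le> C * \<rho> ^ n * norm (?\<pi> v)" by (rule dec[OF inner_proj])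
    also have "\<dots> \<le> C * \<rho> ^ n * c" using C that by (intro mult_left_mono) auto
    finally show ?thesis by (simp add: mult_ac)
  qed
  obtain c0 where c0: "\<And>j p i s. \<sigma> j = p @ i # s \<Longrightarrow> norm (?\<pi> (real_vec (abelianization s))) \<le> c0"
  proof -
    let ?S = "(\<lambda>(j, k). norm (?\<pi> (real_vec (abelianization (drop k (\<sigma> j)))))) ` (SIGMA j:UNIV. {..length (\<sigma> j)})"
    have "finite ?S" by simp
    then have le: "r \<le> Max ?S" if "r \<in> ?S" for r using that by (rule Max_ge)
    have "norm (?\<pi> (real_vec (abelianization s))) \<in> ?S" if "\<sigma> j = p @ i # s" for j p i s
      using that by (intro image_eqI[of _ _ "(j, Suc (length p))"]) auto
    from this[THEN le] show ?thesis by (rule that)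
  qed
  obtain c1 where c1: "\<And>Q f g. Q \<in> L \<Longrightarrow> f \<in> Q \<Longrightarrow> g \<in> Q \<Longrightarrow> norm (?\<pi> (real_vec (fst f - fst g))) \<le> c1"
  proof -
    let ?S = "\<Union>Q\<in>L. (\<lambda>(f, g). norm (?\<pi> (real_vec (fst f - fst g)))) ` (Q \<times> Q)"
    have "finite ?S" using L by simp
    then have le: "r \<le> Max ?S" if "r \<in> ?S" for r using that by (rule Max_ge)
    have "norm (?\<pi> (real_vec (fst f - fst g))) \<in> ?S" if "Q \<in> L" "f \<in> Q" "g \<in> Q" for Q f g
      using that by (intro UN_I image_eqI[of _ _ "(f, g)"]) auto
    from this[THEN le] show ?thesis by (rule that)
  qed
  \<comment> \<open>The first bound makes the ball of a child, with radius smaller by the factor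
    \<rho>, fit into the ball of its parent; the second puts the centers of linked faces within one
    radius of each other. The 0 keeps radii nonnegative, as the signs of \<open>c0\<close> and
    \<open>c1\<close> are not known.\<close>
  define K where "K = max (C * c0 / (1 - \<rho>)) (max (C * c1) 0)"
  have K: "C * c0 \<le> K * (1 - \<rho>)" "C * c1 \<le> K" "0 \<le> K"
  proof -
    have "C * c0 / (1 - \<rho>) \<le> K" by (simp add: K_def)
    then show "C * c0 \<le> K * (1 - \<rho>)" using C by (simp add: pos_divide_le_eq)
  qed (simp_all add: K_def)
  define cb where "cb n f = cball (center n f) (K * \<rho> ^ n)" for n f
  define B where "B n = (\<Union>f\<in>?G n. cb n f)" for n
  have center_cb: "center n f \<in> cb n f" for n f using K C by (simp add: cb_def)
  have child: "cb (Suc n) g \<subseteq> cb n f" if g: "g \<in> E1_star \<sigma> {f}" for n f g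
  proof -
    obtain x i y j where fg: "f = (x, i)" "g = (y, j)" by fastforce
    obtain p s where s: "\<sigma> j = p @ i # s"
      "center (Suc n) g = center n f + ((*v) M ^^ n) (?\<pi> (real_vec (abelianization s)))"
      using center_child[OF g[unfolded fg], of n] unfolding fg by metis
    have "dist (center (Suc n) g) (center n f) \<le> C * c0 * \<rho> ^ n"
      using decay[OF c0[OF s(1)]] by (simp add: s(2) dist_norm)
    also have "\<dots> \<le> K * (1 - \<rho>) * \<rho> ^ n" using C by (intro mult_right_mono K) auto
    finally have "K * \<rho> ^ Suc n + dist (center (Suc n) g) (center n f) \<le> K * \<rho> ^ n"
      by (simp add: algebra_simps)
    then show ?thesis unfolding cb_def cball_subset_cball_iff by simp
  qed
  have adjacent: "\<exists>z. z \<in> cb n f \<and> z \<in> cb n g" if fg: "(f, g) \<in> face_link L (?G n)" for n f g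
  proof -
    obtain Q v where Q: "Q \<in> L" "f \<in> translate v Q" "g \<in> translate v Q"
      using fg unfolding face_link_def by blast
    then obtain f' g' where fg: "f' \<in> Q" "g' \<in> Q" "fst f = v + fst f'" "fst g = v + fst g'"
      unfolding translate_def by force
    have "real_vec (fst f) = real_vec (fst g) + real_vec (fst f' - fst g')"
      unfolding real_vec_add[symmetric] fg by simp
    then have "center n f = center n g + ((*v) M ^^ n) (?\<pi> (real_vec (fst f' - fst g')))"
      unfolding center_def by (simp add: linear_add[OF linear_proj] linear_add[OF linear_funpow])
    then have "dist (center n f) (center n g) \<le> C * c1 * \<rho> ^ n"
      using decay[OF c1[OF Q(1) fg(1,2)]] by (simp add: dist_norm)
    also have "\<dots> \<le> K * \<rho> ^ n" using C by (intro mult_right_mono K) auto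
    finally have "center n f \<in> cb n g" unfolding cb_def by (simp add: dist_commute)
    then show ?thesis using center_cb by blast
  qed
  have compB: "compact (B n)" for n
    unfolding B_def cb_def using finite_E1_star_funpow[OF F(1)] by (intro compact_UN) auto
  have nonB: "B n \<noteq> {}" for n
    unfolding B_def using center_cb E1_star_funpow_nonempty[OF F(2), of n] by blast
  have connB: "connected (B n)" for n
  proof -
    have cbB: "cb n f \<subseteq> B n" if "f \<in> ?G n" for f using that unfolding B_def by blast
    have cc: "connected_component (B n) x y" if "x \<in> cb n f" "y \<in> cb n f" "f \<in> ?G n" for x y f
      unfolding connected_component_def using that cbB[OF that(3)]
      by (intro exI[of _ "cb n f"]) (simp add: cb_def)
    have path: "g \<in> ?G n \<and> connected_component (B n) (center n f) (center n g)"
      if "(f, g) \<in> (face_link L (?G n))\<^sup>*" "f \<in> ?G n" for f g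
      using that
    proof (induction rule: rtrancl_induct)
      case base
      then show ?case using cc[OF center_cb center_cb] by blast
    next
      case (step g h)
      obtain z where z: "z \<in> cb n g" "z \<in> cb n h" using adjacent[OF step(2)] by blast
      have h: "h \<in> ?G n" using step(2) unfolding face_link_def by blast
      have "connected_component (B n) (center n g) z" using cc[OF center_cb z(1)] step by blast
      moreover have "connected_component (B n) z (center n h)" using cc[OF z(2) center_cb h] .
      ultimately show ?case using step h connected_component_trans by blast
    qed
    show ?thesis unfolding connected_iff_connected_component
    proof (intro ballI)
      fix x y assume "x \<in> B n" "y \<in> B n"
      then obtain f g where fg: "f \<in> ?G n" "x \<in> cb n f" "g \<in> ?G n" "y \<in> cb n g" unfolding B_def by blast
      have "connected_component (B n) (center n f) (center n g)"
        using path linked[of n] fg unfolding linked_def by blast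
      then show "connected_component (B n) x y"
        using cc[OF fg(2) center_cb fg(1)] cc[OF center_cb fg(4,3)] connected_component_trans by blast
    qed
  qed
  have "B (Suc n) \<subseteq> B n" for n
  proof
    fix x assume "x \<in> B (Suc n)"
    then obtain g where g: "g \<in> E1_star \<sigma> (?G n)" "x \<in> cb (Suc n) g" unfolding B_def by auto
    obtain f where "f \<in> ?G n" "g \<in> E1_star \<sigma> {f}" using g(1) mem_E1_star_iff_face by blast
    then show "x \<in> B n" using child g(2) unfolding B_def by blast
  qed
  then have nest: "B n \<subseteq> B m" if "m \<le> n" for m n
    using that by (rule lift_Suc_antimono_le)
  define T where "T = \<Inter>(range B)"
  have T: "compact T" "connected T" "T \<noteq> {}"
  proof -
    show "compact T" unfolding T_def by (rule compact_Inter) (use compB in auto)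
    show "connected T" unfolding T_def by (rule connected_nest[OF compB connB nest])
    show "T \<noteq> {}" unfolding T_def by (rule compact_nest[OF compB nonB nest])
  qed
  \<comment> \<open>An infinite line of descendants of \<open>f\<close> has nested compact balls,
    and a common point of these belongs to every \<open>B k\<close>. Hence no face of level
    \<open>n\<close> is far from \<open>T\<close>.\<close>
  have near: "\<exists>t\<in>T. dist (center n f) t \<le> K * \<rho> ^ n" if f: "f \<in> ?G n" for n f
  proof -
    have "\<exists>h. \<forall>m. (h m \<in> ?G (n + m) \<and> (m = 0 \<longrightarrow> h m = f)) \<and> h (Suc m) \<in> E1_star \<sigma> {h m}"
    proof (rule dependent_nat_choice)
      show "\<exists>x. x \<in> ?G (n + 0) \<and> ((0::nat) = 0 \<longrightarrow> x = f)"
        by (rule exI[of _ f]) (simp add: f)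
      fix x m assume x: "x \<in> ?G (n + m) \<and> (m = 0 \<longrightarrow> x = f)"
      obtain y where y: "y \<in> E1_star \<sigma> {x}" using E1_star_nonempty[OF invertible] by blast
      then have "y \<in> E1_star \<sigma> (?G (n + m))"
        using E1_star_mono[of "{x}" "?G (n + m)" \<sigma>] x by blast
      with y show "\<exists>y. (y \<in> ?G (n + Suc m) \<and> (Suc m = 0 \<longrightarrow> y = f)) \<and> y \<in> E1_star \<sigma> {x}"
        by (intro exI[of _ y]) simp
    qed
    then obtain h where h: "\<And>m. h m \<in> ?G (n + m)" "h 0 = f" "\<And>m. h (Suc m) \<in> E1_star \<sigma> {h m}" by blast
    have nest_h: "cb (n + m) (h m) \<subseteq> cb (n + k) (h k)" if "k \<le> m" for k m
      using that by (rule lift_Suc_antimono_le[rotated]) (simp add: child h)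
    have "\<Inter>(range (\<lambda>m. cb (n + m) (h m))) \<noteq> {}"
    proof (rule compact_nest)
      show "compact (cb (n + m) (h m))" for m by (simp add: cb_def)
      show "cb (n + m) (h m) \<noteq> {}" for m using center_cb by blast
    qed (rule nest_h)
    then obtain t where t: "\<And>m. t \<in> cb (n + m) (h m)" by blast
    have "t \<in> B k" for k
    proof -
      have "t \<in> B (n + k)" using t h(1) unfolding B_def by blast
      then show ?thesis using nest[of k "n + k"] by auto
    qed
    moreover have "dist (center n f) t \<le> K * \<rho> ^ n" using t[of 0] by (simp add: cb_def h(2))
    ultimately show ?thesis unfolding T_def by blast
  qed
  obtain b where b: "b > 0" "\<And>x. norm (?\<pi> x) \<le> b * norm x"
    using linear_bounded_pos[OF linear_proj] by blast
  \<comment> \<open>Ball radius plus the extent of a projected face: a point of a face differs from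
    its base point by a vector of norm at most 2, and \<open>b\<close> bounds the
    projection.\<close>
  define e where "e n = (K + C * (b * 2)) * \<rho> ^ n" for n
  have A1: "infdist a T \<le> e n" if a: "a \<in> ?A n" for a n
  proof -
    obtain f v where fv: "f \<in> ?G n" "norm v \<le> 2" "a = center n f + ((*v) M ^^ n) (?\<pi> v)"
      using a by (rule rauzy_approx_near_center)
    have "norm (?\<pi> v) \<le> b * 2" using b fv(2) by (meson mult_left_mono less_imp_le order.trans)
    then have "dist a (center n f) \<le> C * (b * 2) * \<rho> ^ n"
      using decay by (simp add: fv(3) dist_norm)
    moreover obtain t where t: "t \<in> T" "dist (center n f) t \<le> K * \<rho> ^ n" using near[OF fv(1)] by blast
    ultimately have "dist a t \<le> e n"
      using dist_triangle[of a t "center n f"] unfolding e_def by (simp add: distrib_right)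
    then show ?thesis using infdist_le[OF t(1), of a] by linarith
  qed
  have A2: "infdist t (?A n) \<le> e n" if t: "t \<in> T" for t n
  proof -
    have "t \<in> B n" using t unfolding T_def by blast
    then obtain f where f: "f \<in> ?G n" "dist (center n f) t \<le> K * \<rho> ^ n" unfolding B_def cb_def by auto
    have "infdist t (?A n) \<le> dist t (center n f)" by (rule infdist_le[OF center_in_rauzy_approx[OF f(1)]])
    also have "\<dots> \<le> e n" unfolding e_def using f(2) C b(1) by (simp add: dist_commute distrib_right add_increasing2)
    finally show ?thesis .
  qed
  have nonA: "?A n \<noteq> {}" for n
    using center_in_rauzy_approx E1_star_funpow_nonempty[OF F(2), of n] by blast
  \<comment> \<open>Boundedness is read off from the uniform distance to the compact set
    \<open>T\<close>.\<close>
  have bA: "bounded (?A n)" for n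
  proof -
    obtain r where r: "\<And>t. t \<in> T \<Longrightarrow> norm t \<le> r"
      using compact_imp_bounded[OF T(1)] unfolding bounded_iff by blast
    have "norm a \<le> r + e n" if "a \<in> ?A n" for a
    proof -
      obtain t where "t \<in> T" "infdist a T = dist a t" using infdist_attains_inf[OF compact_imp_closed[OF T(1)] T(3)] by blast
      then show ?thesis using A1[OF that] r[of t] norm_triangle_sub[of a t] by (simp add: dist_norm)
    qed
    then show ?thesis unfolding bounded_iff by blast
  qed
  have "(\<lambda>n. hausdorff_distance (?A n) T) \<longlonglongrightarrow> 0"
  proof (rule tendsto_sandwich)
    have "0 \<le> hausdorff_distance (?A n) T" for n
    proof -
      obtain a where "a \<in> ?A n" using nonA by blast
      then show ?thesis
        using infdist_le_hausdorff_distance[OF bA compact_imp_bounded[OF T(1)] T(3)] infdist_nonneg order.trans by blast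
    qed
    then show "\<forall>\<^sub>F n in sequentially. 0 \<le> hausdorff_distance (?A n) T" by simp
    show "\<forall>\<^sub>F n in sequentially. hausdorff_distance (?A n) T \<le> e n"
      using hausdorff_distance_le[OF nonA T(3) A1 A2] by simp
    have "(\<lambda>n. (K + C * (b * 2)) * \<rho> ^ n) \<longlonglongrightarrow> (K + C * (b * 2)) * 0"
      using C by (intro tendsto_intros LIMSEQ_power_zero) simp
    then show "e \<longlonglongrightarrow> 0" unfolding e_def by simp
  qed simp
  then have "is_hausdorff_limit ?A T" unfolding is_hausdorff_limit_def using T by blast
  then show ?thesis using hausdorff_limit_eq[OF bA nonA] T(2) by simp
qed

end

subsection \<open>Chains of faces for Jacobi--Perron and Brun substitutions\<close>

lemma E1_star_face_iff:
  assumes "invertible (incidence_matrix \<sigma>)"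
  shows "(y, j) \<in> E1_star \<sigma> {(x, i)} \<longleftrightarrow>
    (\<exists>p s. \<sigma> j = p @ i # s \<and> incidence_matrix \<sigma> *v y = x + abelianization s)"
  by (auto simp: E1_star_iff[OF assms])

text \<open>Reduces a two-face pattern to one witness: a translate by \<open>v\<close> of a pattern
  \<open>{(0, i), (d, j)}\<close> with one face among the children of \<open>f\<close> and the other
  among those of \<open>g\<close>. The disjunction allows either orientation.\<close>

lemma linked_E1_star_pair:
  assumes inv: "invertible (incidence_matrix \<sigma>)"
    and face: "\<And>i. linked L (E1_star \<sigma> {(0, i)})"
    and Q: "{(0, i), (d, j)} \<in> L"
    and fg: "(v, i) \<in> E1_star \<sigma> {f} \<and> (v + d, j) \<in> E1_star \<sigma> {g} \<or>
      (v, i) \<in> E1_star \<sigma> {g} \<and> (v + d, j) \<in> E1_star \<sigma> {f}"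
  shows "linked L (E1_star \<sigma> {f, g})"
proof -
  have face': "linked L (E1_star \<sigma> {h})" for h
  proof -
    obtain x i where h: "h = (x, i)" by fastforce
    have "{h} = translate x {(0, i)}" by (simp add: h)
    then show ?thesis using E1_star_translate[OF inv] linked_translate[OF face] by metis
  qed
  have Un: "E1_star \<sigma> {f, g} = E1_star \<sigma> {f} \<union> E1_star \<sigma> {g}"
    unfolding E1_star_def by blast
  from fg show ?thesis
  proof
    assume *: "(v, i) \<in> E1_star \<sigma> {f} \<and> (v + d, j) \<in> E1_star \<sigma> {g}"
    show ?thesis unfolding Un
      by (rule linked_Un_bridge[OF face' face' Q, of v _ _ "(v, i)" "(v + d, j)"]) (use * in auto)
  next
    assume *: "(v, i) \<in> E1_star \<sigma> {g} \<and> (v + d, j) \<in> E1_star \<sigma> {f}"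
    show ?thesis unfolding Un
      by (rule linked_Un_bridge[OF face' face' Q, of v _ _ "(v + d, j)" "(v, i)"]) (use * in auto)
  qed
qed

text \<open>The flag tells whether the previous factor had \<open>a = b\<close>.  Only then may the last pattern arise,
  and only for the next factor with \<open>a \<noteq> 0\<close> does it have a connected image: this is where
  admissibility is needed.\<close>

definition jp_patterns :: "bool \<Rightarrow> face set set" where
  "jp_patterns c = {{(0, 2), (vector [0, -1, 1], 3)}, {(0, 3), (vector [1, 0, 0], 3)},
      {(0, 1), (vector [-1, 1, 0], 2)}, {(0, 3), (vector [0, 1, 0], 3)}, {(0, 1), (0, 3)},
      {(0, 2), (0, 3)}, {(0, 1), (vector [-1, 0, 1], 3)}} \<union>
    (if c then {{(0, 2), (vector [-1, 0, 0], 3)}} else {})"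

section \<open>Images of faces and patterns under the dual Jacobi-Perron substitutions\<close>

lemma ex_Cons_replicate_eq_append:
  "(\<exists>p s. x # replicate n y = p @ i # s \<and> P s) \<longleftrightarrow>
    i = x \<and> P (replicate n y) \<or> i = y \<and> (\<exists>l<n. P (replicate l y))"
proof -
  have "(\<exists>p. replicate n y = p @ i # s) \<longleftrightarrow> i = y \<and> (\<exists>l<n. s = replicate l y)" for s
  proof
    assume "\<exists>p. replicate n y = p @ i # s"
    then obtain p where *: "replicate n y = p @ i # s" ..
    then have "length (replicate n y) = length (p @ i # s)" by simp
    then have n: "length s < n" by simp
    have "set (p @ i # s) \<subseteq> {y}" unfolding *[symmetric] by (simp add: set_replicate_conv_if)
    then have "i = y" "s = replicate (length s) y"
      by (auto intro!: replicate_eqI)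
    then show "i = y \<and> (\<exists>l<n. s = replicate l y)" using n by blast
  next
    assume "i = y \<and> (\<exists>l<n. s = replicate l y)"
    then obtain l where l: "i = y" "l < n" "s = replicate l y" by blast
    then have "replicate n y = replicate (n - Suc l) y @ replicate (Suc l) y"
      by (simp flip: replicate_add del: replicate_Suc)
    then show "\<exists>p. replicate n y = p @ i # s" using l by auto
  qed
  then show ?thesis by (auto simp: Cons_eq_append_conv) metis+
qed

lemma ex_Cons_eq_append:
  "(\<exists>p s. x # w = p @ i # s \<and> P s) \<longleftrightarrow> i = x \<and> P w \<or> (\<exists>p s. w = p @ i # s \<and> P s)"
  unfolding Cons_eq_append_conv by blast

lemma ex_singleton_eq_append: "(\<exists>p s. [x] = p @ i # s \<and> P s) \<longleftrightarrow> i = x \<and> P []"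
  using ex_Cons_replicate_eq_append[of x 0] by simp

lemma abelianization_replicate: "abelianization (replicate n i) = axis i (int n)"
  by (induction n) (auto simp: vec_eq_iff axis_def)

lemma mem_E1_star_jacobi_perron:
  defines "M \<equiv> \<lambda>(a :: nat) (b :: nat) (y :: int^3). vector [y $ 2, y $ 3, y $ 1 + int a * y $ 2 + int b * y $ 3] :: int^3"
  shows "(y, 2) \<in> E1_star (jacobi_perron (a, b)) {(x, 1)} \<longleftrightarrow> M a b y = x + axis 3 (int a)"
    "(y, 3) \<in> E1_star (jacobi_perron (a, b)) {(x, 2)} \<longleftrightarrow> M a b y = x + axis 3 (int b)"
    "(y, 1) \<in> E1_star (jacobi_perron (a, b)) {(x, 3)} \<longleftrightarrow> M a b y = x"
    "(y, 2) \<in> E1_star (jacobi_perron (a, b)) {(x, 3)} \<longleftrightarrow> (\<exists>l<a. M a b y = x + axis 3 (int l))"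
    "(y, 3) \<in> E1_star (jacobi_perron (a, b)) {(x, 3)} \<longleftrightarrow> (\<exists>l<b. M a b y = x + axis 3 (int l))"
    "(y, 1) \<notin> E1_star (jacobi_perron (a, b)) {(x, 1)}" "(y, 3) \<notin> E1_star (jacobi_perron (a, b)) {(x, 1)}"
    "(y, 1) \<notin> E1_star (jacobi_perron (a, b)) {(x, 2)}" "(y, 2) \<notin> E1_star (jacobi_perron (a, b)) {(x, 2)}"
  unfolding E1_star_face_iff[OF invertible_incidence_jacobi_perron] incidence_jacobi_perron_mult M_def
  by (auto simp: jacobi_perron_def ex_Cons_replicate_eq_append ex_singleton_eq_append abelianization_replicate)

lemma vector_3_eq_iff:
  "vector [p, q, r] = (x :: int^3) \<longleftrightarrow> p = x $ 1 \<and> q = x $ 2 \<and> r = x $ 3"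
  by (auto simp: vec_eq_iff forall_3)

lemma linked_insertI:
  assumes "linked L F" "Q \<in> L" "translate v Q \<subseteq> insert f F" "f \<in> translate v Q" "g \<in> translate v Q" "g \<in> F"
  shows "linked L (insert f F)"
  using linked_Un_bridge[of L "{f}" F Q v f g] assms by auto

text \<open>Only the image of \<open>(0, 3)\<close> has several faces: \<open>(0, 1)\<close>, a row
  of \<open>b\<close> faces of type 3 and a row of \<open>a\<close> faces of type 2 along the first
  axis. As \<open>b \<ge> 1\<close>, the first of these is attached to \<open>(0, 3)\<close>; as
  \<open>a \<le> b\<close>, every type 2 face has a type 3 face at its own base point.\<close>

lemma linked_E1_star_jacobi_perron_face:
  assumes "a \<le> b" "b \<noteq> 0"
  shows "linked (jp_patterns c) (E1_star (jacobi_perron (a, b)) {(0, i)})"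
proof -
  let ?L = "jp_patterns c" and ?E = "\<lambda>i. E1_star (jacobi_perron (a, b)) {(0, i)}"
  let ?v = "\<lambda>l::nat. vector [int l, 0, 0] :: int^3"
  have E1: "?E 1 = {(?v a, 2)}"
  proof -
    have "(y, j) \<in> ?E 1 \<longleftrightarrow> (y, j) \<in> {(?v a, 2)}" for y j
      using exhaust_3[of j] by (auto simp: mem_E1_star_jacobi_perron vector_3_eq_iff vec_eq_iff forall_3 axis_def)
    then show ?thesis unfolding set_eq_iff split_paired_All by blast
  qed
  have E2: "?E 2 = {(?v b, 3)}"
  proof -
    have "(y, j) \<in> ?E 2 \<longleftrightarrow> (y, j) \<in> {(?v b, 3)}" for y j
      using exhaust_3[of j] by (auto simp: mem_E1_star_jacobi_perron vector_3_eq_iff vec_eq_iff forall_3 axis_def)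
    then show ?thesis unfolding set_eq_iff split_paired_All by blast
  qed
  let ?G = "\<lambda>n m. {(0, 1)} \<union> (\<lambda>l. (?v l, 3)) ` {..<n} \<union> (\<lambda>l. (?v l, 2)) ` {..<m} :: face set"
  have E3: "?E 3 = ?G b a"
  proof -
    have "(y, j) \<in> ?E 3 \<longleftrightarrow> (y, j) \<in> ?G b a" for y j
      using exhaust_3[of j] by (auto simp: mem_E1_star_jacobi_perron vector_3_eq_iff vec_eq_iff forall_3 axis_def)
    then show ?thesis unfolding set_eq_iff split_paired_All by blast
  qed
  have n: "linked ?L (?G (Suc n) 0)" for n
  proof (induction n)
    case 0
    have "linked ?L (translate 0 {(0, 1), (0, 3)})"
      by (rule linked_pattern) (simp add: jp_patterns_def)
    moreover have "?G (Suc 0) 0 = {(0, 1), (0, 3)}"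
      by (auto simp: lessThan_Suc vec_eq_iff forall_3)
    ultimately show ?case by simp
  next
    case (Suc n)
    have eq: "?G (Suc (Suc n)) 0 = insert (?v (Suc n), 3) (?G (Suc n) 0)"
      by (auto simp: lessThan_Suc)
    have v: "?v n + vector [1, 0, 0] = ?v (Suc n)" by (simp add: vec_eq_iff forall_3)
    show ?case unfolding eq
      by (rule linked_insertI[OF Suc, of "{(0, 3), (vector [1, 0, 0], 3)}" "?v n" _ "(?v n, 3)"])
        (auto simp: jp_patterns_def v)
  qed
  have "m \<le> b \<Longrightarrow> linked ?L (?G b m)" for m
  proof (induction m)
    case 0
    then show ?case using n[of "b - 1"] assms(2) by simp
  next
    case (Suc m)
    have eq: "?G b (Suc m) = insert (?v m, 2) (?G b m)" by (auto simp: lessThan_Suc)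
    have IH: "linked ?L (?G b m)" using Suc by simp
    show ?case unfolding eq
      by (rule linked_insertI[OF IH, of "{(0, 2), (0, 3)}" "?v m" _ "(?v m, 3)"])
        (use Suc.prems in \<open>auto simp: jp_patterns_def\<close>)
  qed
  then have "linked ?L (?E 3)" unfolding E3 using assms(1) .
  then show ?thesis using exhaust_3[of i] E1 E2 by auto
qed

text \<open>All offsets come from solving \<open>M y = z\<close>, that is
  \<open>y = (z3 - a z1 - b z2, z1, z2)\<close>. In the numbering of the cases the bridges are 1 to
  7, 7 to 3 and 3 to 1, a closed cycle, which the others enter: 5 leads to 6 or 8, 6 to 2, 2 to 3 or
  4, 8 to 4, and 4 to 7.\<close>

lemma linked_E1_star_jacobi_perron:
  assumes ab: "a \<le> b" "b \<noteq> 0" and c: "c \<Longrightarrow> a \<noteq> 0"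
    and F: "linked (jp_patterns c) F"
  shows "linked (jp_patterns (a = b)) (E1_star (jacobi_perron (a, b)) F)"
proof (rule linked_E1_star[OF invertible_incidence_jacobi_perron _ _ F])
  let ?L = "jp_patterns (a = b)"
  show face: "linked ?L (E1_star (jacobi_perron (a, b)) {(0, i)})" for i
    by (rule linked_E1_star_jacobi_perron_face[OF ab])
  note pair = linked_E1_star_pair[OF invertible_incidence_jacobi_perron face]
  fix Q assume "Q \<in> jp_patterns c"
  then consider "Q = {(0, 2), (vector [0, -1, 1], 3)}" | "Q = {(0, 3), (vector [1, 0, 0], 3)}" |
    "Q = {(0, 1), (vector [-1, 1, 0], 2)}" | "Q = {(0, 3), (vector [0, 1, 0], 3)}" | "Q = {(0, 1), (0, 3)}" |
    "Q = {(0, 2), (0, 3)}" | "Q = {(0, 1), (vector [-1, 0, 1], 3)}" | "Q = {(0, 2), (vector [-1, 0, 0], 3)}" "c"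
    unfolding jp_patterns_def by (cases c) (simp_all only: if_True if_False Un_empty_right Un_iff insert_iff empty_iff, metis+)
  then show "linked ?L (E1_star (jacobi_perron (a, b)) Q)"
  proof cases
    case 1
    show ?thesis unfolding 1
      by (rule pair[of 1 "vector [-1, 0, 1]" 3 "vector [int b + 1, 0, -1]"])
        (auto simp: jp_patterns_def mem_E1_star_jacobi_perron vector_3_eq_iff axis_def algebra_simps)
  next
    case 2
    \<comment> \<open>The children of the second face lie at \<open>(l - a, 1, 0)\<close>. For
      \<open>a < b\<close> the choice \<open>l = a\<close> is allowed for type 3 and gives the
      offset \<open>(0, 1, 0)\<close>; for \<open>a = b\<close> the type 2 child with
      \<open>l = a - 1\<close> is used.\<close>
    show ?thesis
    proof (cases "a = b")
      case True
      then show ?thesis unfolding 2 using ab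
        by (intro pair[of 1 "vector [-1, 1, 0]" 2 0])
          (auto simp: jp_patterns_def mem_E1_star_jacobi_perron vector_3_eq_iff axis_def algebra_simps
            intro!: exI[of _ "a - 1"])
    next
      case False
      then show ?thesis unfolding 2 using ab
        by (intro pair[of 3 "vector [0, 1, 0]" 3 0])
          (auto simp: jp_patterns_def mem_E1_star_jacobi_perron vector_3_eq_iff axis_def algebra_simps
            intro!: exI[of _ a])
    qed
  next
    case 3
    show ?thesis unfolding 3
      by (rule pair[of 2 "vector [0, -1, 1]" 3 "vector [int a, 0, 0]"])
        (auto simp: jp_patterns_def mem_E1_star_jacobi_perron vector_3_eq_iff axis_def algebra_simps)
  next
    case 4
    show ?thesis unfolding 4 using ab
      by (intro pair[of 1 "vector [-1, 0, 1]" 3 0])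
        (auto simp: jp_patterns_def mem_E1_star_jacobi_perron vector_3_eq_iff axis_def algebra_simps
            intro!: exI[of _ "b - 1"])
  next
    case 5
    \<comment> \<open>The face \<open>(0, 1)\<close> has its child at \<open>(a, 0, 0)\<close>, but
      the type 3 children of \<open>(0, 3)\<close> stop at \<open>(b - 1, 0, 0)\<close>. For
      \<open>a = b\<close> they fall one short, which creates the flagged pattern.\<close>
    show ?thesis
    proof (cases "a = b")
      case True
      then show ?thesis unfolding 5 using ab
        by (intro pair[of 2 "vector [-1, 0, 0]" 3 "vector [int a, 0, 0]"])
          (auto simp: jp_patterns_def mem_E1_star_jacobi_perron vector_3_eq_iff axis_def algebra_simps
            intro!: exI[of _ "b - 1"])
    next
      case False
      then show ?thesis unfolding 5 using ab
        by (intro pair[of 2 0 3 "vector [int a, 0, 0]"])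
          (auto simp: jp_patterns_def mem_E1_star_jacobi_perron vector_3_eq_iff axis_def algebra_simps)
    qed
  next
    case 6
    show ?thesis unfolding 6 using ab
      by (intro pair[of 3 "vector [1, 0, 0]" 3 "vector [int b - 1, 0, 0]"])
        (auto simp: jp_patterns_def mem_E1_star_jacobi_perron vector_3_eq_iff axis_def algebra_simps
            intro!: exI[of _ "b - 1"])
  next
    case 7
    show ?thesis unfolding 7
      by (rule pair[of 1 "vector [-1, 1, 0]" 2 "vector [int a + 1, -1, 0]"])
        (auto simp: jp_patterns_def mem_E1_star_jacobi_perron vector_3_eq_iff axis_def algebra_simps)
  next
    case 8
    \<comment> \<open>The bridging child has suffix length \<open>b - a\<close>, which has to be
      less than \<open>b\<close>.\<close>
    then have "a \<noteq> 0" using c by simp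
    then show ?thesis unfolding 8(1) using ab
      by (intro pair[of 3 "vector [0, 1, 0]" 3 "vector [int b, -1, 0]"])
        (auto simp: jp_patterns_def mem_E1_star_jacobi_perron vector_3_eq_iff axis_def algebra_simps
          intro!: exI[of _ "b - a"])
  qed
qed

text \<open>Two faces alone would not do: under powers of the first substitution the images of
  \<open>(0, 1)\<close> and \<open>(0, 3)\<close> drift apart, and are only linked through the image of \<open>(0, 2)\<close>.\<close>

definition brun_patterns :: "face set set" where
  "brun_patterns = {{(0, 1), (0, 2), (0, 3)}, {(0, 2), (0, 3)}, {(0, 3), (vector [0, 1, 0], 3)},
      {(0, 1), (vector [-1, 1, 0], 2)}, {(0, 1), (vector [-1, 0, 1], 3)}, {(0, 3), (vector [1, 0, 0], 3)},
      {(0, 2), (vector [0, -1, 1], 3)}}"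

section \<open>Images of faces and patterns under the dual Brun substitutions\<close>

lemma mem_E1_star_brun:
  "(y, j) \<in> E1_star (brun 1) {(x, i)} \<longleftrightarrow>
    i = 1 \<and> j = 1 \<and> y = vector [x $ 1, x $ 2 - x $ 3, x $ 3] \<or>
    i = 2 \<and> (j = 2 \<or> j = 3) \<and> y = vector [x $ 1, x $ 2 - x $ 3, x $ 3] \<or>
    i = 3 \<and> j = 3 \<and> y = vector [x $ 1, x $ 2 - x $ 3 + 1, x $ 3]"
  "(y, j) \<in> E1_star (brun 2) {(x, i)} \<longleftrightarrow>
    i = 1 \<and> j = 1 \<and> y = vector [x $ 1, x $ 3 - x $ 2, x $ 2] \<or>
    i = 2 \<and> j = 3 \<and> y = vector [x $ 1, x $ 3 - x $ 2 + 1, x $ 2] \<or>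
    i = 3 \<and> (j = 2 \<or> j = 3) \<and> y = vector [x $ 1, x $ 3 - x $ 2, x $ 2]"
  "(y, j) \<in> E1_star (brun 3) {(x, i)} \<longleftrightarrow>
    i = 1 \<and> j = 3 \<and> y = vector [x $ 2, x $ 3 - x $ 1 + 1, x $ 1] \<or>
    i = 2 \<and> j = 1 \<and> y = vector [x $ 2, x $ 3 - x $ 1, x $ 1] \<or>
    i = 3 \<and> (j = 2 \<or> j = 3) \<and> y = vector [x $ 2, x $ 3 - x $ 1, x $ 1]"
  unfolding E1_star_face_iff[OF invertible_incidence_brun] incidence_brun_mult
  using exhaust_3[of i] exhaust_3[of j]
  by (elim disjE; simp add: brun_def ex_Cons_eq_append vec_eq_iff forall_3 axis_def; linarith)+

lemma vector_3_0: "vector [0, 0, 0] = (0 :: int^3)"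
  by (simp add: vec_eq_iff forall_3)

lemma E1_star_brun_face:
  "E1_star (brun 1) {(0, 1)} = {(0, 1)}"
  "E1_star (brun 1) {(0, 2)} = {(0, 2), (0, 3)}"
  "E1_star (brun 1) {(0, 3)} = {(vector [0, 1, 0], 3)}"
  "E1_star (brun 2) {(0, 1)} = {(0, 1)}"
  "E1_star (brun 2) {(0, 2)} = {(vector [0, 1, 0], 3)}"
  "E1_star (brun 2) {(0, 3)} = {(0, 2), (0, 3)}"
  "E1_star (brun 3) {(0, 1)} = {(vector [0, 1, 0], 3)}"
  "E1_star (brun 3) {(0, 2)} = {(0, 1)}"
  "E1_star (brun 3) {(0, 3)} = {(0, 2), (0, 3)}"
  unfolding set_eq_iff split_paired_All mem_E1_star_brun by (auto simp: vector_3_0)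

lemma E1_star_insert: "E1_star \<sigma> (insert f F) = E1_star \<sigma> {f} \<union> E1_star \<sigma> F" if "F \<noteq> {}"
  unfolding E1_star_def by blast

text \<open>In the numbering of the cases, the bridges under \<open>brun 1\<close>,
  \<open>brun 2\<close>, \<open>brun 3\<close> lead from 3 to 3, 7, 6; from 4 to 4, 5, 5; from 5 to
  5, 4, 7; from 6 to 6, 6, 7; from 7 to 7, 7, 4. Pattern 2 leads to 3 under the first two, and its
  image under \<open>brun 3\<close> is exactly the three-face pattern.\<close>

lemma linked_E1_star_brun:
  assumes F: "linked brun_patterns F"
  shows "linked brun_patterns (E1_star (brun k) F)"
proof (rule linked_E1_star[OF invertible_incidence_brun _ _ F])
  let ?L = brun_patterns
  have E: "E1_star (brun k) {(0, i)} = {(0, 1)} \<or> E1_star (brun k) {(0, i)} = {(vector [0, 1, 0], 3)} \<or>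
    E1_star (brun k) {(0, i)} = {(0, 2), (0, 3)}" for i k
    using exhaust_3[of k] exhaust_3[of i] by (elim disjE) (simp_all only: E1_star_brun_face simp_thms)
  have L: "linked ?L {(0, 2), (0, 3)}"
    using linked_pattern[of "{(0, 2), (0, 3)}" ?L 0] by (simp add: brun_patterns_def)
  have face: "linked ?L (E1_star (brun k) {(0, i)})" for i k
    using E[of k i] by (elim disjE) (simp_all only: L linked_singleton)
  then show "linked ?L (E1_star (brun k) {(0, i)})" for i .
  note pair = linked_E1_star_pair[OF invertible_incidence_brun face]
  have U: "linked ?L (translate 0 {(0, 1), (0, 2), (0, 3)})"
    by (rule linked_pattern) (simp add: brun_patterns_def)
  note simps = brun_patterns_def mem_E1_star_brun vec_eq_iff forall_3
  fix Q assume "Q \<in> brun_patterns"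
  then consider "Q = {(0, 1), (0, 2), (0, 3)}" | "Q = {(0, 2), (0, 3)}" | "Q = {(0, 3), (vector [0, 1, 0], 3)}" |
    "Q = {(0, 1), (vector [-1, 1, 0], 2)}" | "Q = {(0, 1), (vector [-1, 0, 1], 3)}" |
    "Q = {(0, 3), (vector [1, 0, 0], 3)}" | "Q = {(0, 2), (vector [0, -1, 1], 3)}"
    unfolding brun_patterns_def insert_iff empty_iff by metis
  then show "linked ?L (E1_star (brun k) Q)"
  proof cases
    case 1
    \<comment> \<open>The three substitutions only permute which face contributes what: the image of
      the three unit faces is always these faces together with one neighbour.\<close>
    have "E1_star (brun k) Q = insert (vector [0, 1, 0], 3) (translate 0 {(0, 1), (0, 2), (0, 3)})"
      unfolding 1 using exhaust_3[of k] by (elim disjE) (auto simp: E1_star_insert E1_star_brun_face)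
    moreover have "linked ?L (insert (vector [0, 1, 0], 3) (translate 0 {(0, 1), (0, 2), (0, 3)}))"
      by (rule linked_insertI[OF U, of "{(0, 3), (vector [0, 1, 0], 3)}" 0 _ "(0, 3)"])
        (auto simp: brun_patterns_def)
    ultimately show ?thesis by simp
  next
    case 2
    have "linked ?L (E1_star (brun 1) Q)" unfolding 2
      by (rule pair[of 3 "vector [0, 1, 0]" 3 0]) (auto simp: simps)
    moreover have "linked ?L (E1_star (brun 2) Q)" unfolding 2
      by (rule pair[of 3 "vector [0, 1, 0]" 3 0]) (auto simp: simps)
    moreover have "E1_star (brun 3) Q = translate 0 {(0, 1), (0, 2), (0, 3)}"
      unfolding 2 by (simp add: E1_star_insert E1_star_brun_face insert_commute)
    then have "linked ?L (E1_star (brun 3) Q)" using U by simp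
    ultimately show ?thesis using exhaust_3[of k] by auto
  next
    case 3
    have "linked ?L (E1_star (brun 1) Q)" unfolding 3
      by (rule pair[of 3 "vector [0, 1, 0]" 3 "vector [0, 1, 0]"]) (auto simp: simps)
    moreover have "linked ?L (E1_star (brun 2) Q)" unfolding 3
      by (rule pair[of 2 "vector [0, -1, 1]" 3 0]) (auto simp: simps)
    moreover have "linked ?L (E1_star (brun 3) Q)" unfolding 3
      by (rule pair[of 3 "vector [1, 0, 0]" 3 0]) (auto simp: simps)
    ultimately show ?thesis using exhaust_3[of k] by auto
  next
    case 4
    have "linked ?L (E1_star (brun 1) Q)" unfolding 4
      by (rule pair[of 1 "vector [-1, 1, 0]" 2 0]) (auto simp: simps)
    moreover have "linked ?L (E1_star (brun 2) Q)" unfolding 4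
      by (rule pair[of 1 "vector [-1, 0, 1]" 3 0]) (auto simp: simps)
    moreover have "linked ?L (E1_star (brun 3) Q)" unfolding 4
      by (rule pair[of 1 "vector [-1, 0, 1]" 3 "vector [1, 1, -1]"]) (auto simp: simps)
    ultimately show ?thesis using exhaust_3[of k] by auto
  next
    case 5
    have "linked ?L (E1_star (brun 1) Q)" unfolding 5
      by (rule pair[of 1 "vector [-1, 0, 1]" 3 0]) (auto simp: simps)
    moreover have "linked ?L (E1_star (brun 2) Q)" unfolding 5
      by (rule pair[of 1 "vector [-1, 1, 0]" 2 0]) (auto simp: simps)
    moreover have "linked ?L (E1_star (brun 3) Q)" unfolding 5
      by (rule pair[of 2 "vector [0, -1, 1]" 3 "vector [0, 2, -1]"]) (auto simp: simps)
    ultimately show ?thesis using exhaust_3[of k] by auto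
  next
    case 6
    have "linked ?L (E1_star (brun 1) Q)" unfolding 6
      by (rule pair[of 3 "vector [1, 0, 0]" 3 "vector [0, 1, 0]"]) (auto simp: simps)
    moreover have "linked ?L (E1_star (brun 2) Q)" unfolding 6
      by (rule pair[of 3 "vector [1, 0, 0]" 3 0]) (auto simp: simps)
    moreover have "linked ?L (E1_star (brun 3) Q)" unfolding 6
      by (rule pair[of 2 "vector [0, -1, 1]" 3 0]) (auto simp: simps)
    ultimately show ?thesis using exhaust_3[of k] by auto
  next
    case 7
    have "linked ?L (E1_star (brun 1) Q)" unfolding 7
      by (rule pair[of 2 "vector [0, -1, 1]" 3 0]) (auto simp: simps)
    moreover have "linked ?L (E1_star (brun 2) Q)" unfolding 7
      by (rule pair[of 2 "vector [0, -1, 1]" 3 "vector [0, 2, -1]"]) (auto simp: simps)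
    moreover have "linked ?L (E1_star (brun 3) Q)" unfolding 7
      by (rule pair[of 1 "vector [-1, 1, 0]" 2 0]) (auto simp: simps)
    ultimately show ?thesis using exhaust_3[of k] by auto
  qed
qed

subsection \<open>Connectedness\<close>

lemma linked_E1_star_brun_prod:
  assumes "linked brun_patterns F"
  shows "linked brun_patterns (E1_star (subst_prod (map brun ks)) F)"
  using assms
proof (induction ks arbitrary: F)
  case (Cons k ks)
  have "invertible (incidence_matrix (subst_prod (map brun ks)))"
    by (rule invertible_incidence_subst_prod) (auto simp: invertible_incidence_brun)
  then show ?case
    using Cons by (simp add: E1_star_subst_comp invertible_incidence_brun linked_E1_star_brun)
qed (simp add: E1_star_id)

text \<open>The flag travels along the product: it enters as \<open>c\<close>, is tested against the
  first factor, and leaves as the flag of the last. The cyclic condition thus splits into its linear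
  part and the assumption on \<open>c\<close>.\<close>

lemma linked_E1_star_jacobi_perron_prod:
  assumes "\<forall>k<length ps. fst (ps ! k) \<le> snd (ps ! k) \<and> snd (ps ! k) \<noteq> 0"
    and "\<forall>k. Suc k < length ps \<longrightarrow> fst (ps ! k) = snd (ps ! k) \<longrightarrow> fst (ps ! Suc k) \<noteq> 0"
    and "ps \<noteq> []" "c \<Longrightarrow> fst (hd ps) \<noteq> 0" "linked (jp_patterns c) F"
  shows "linked (jp_patterns (fst (last ps) = snd (last ps))) (E1_star (subst_prod (map jacobi_perron ps)) F)"
  using assms
proof (induction ps arbitrary: F c)
  case (Cons p ps)
  obtain a b where p: "p = (a, b)" by fastforce
  have ab: "a \<le> b" "b \<noteq> 0" using Cons.prems(1) by (auto simp: p)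
  have link: "linked (jp_patterns (a = b)) (E1_star (jacobi_perron p) F)"
    unfolding p using Cons.prems(4,5) by (intro linked_E1_star_jacobi_perron[OF ab, of c]) (simp_all add: p)
  have inv: "invertible (incidence_matrix (subst_prod (map jacobi_perron ps)))"
    by (rule invertible_incidence_subst_prod) (auto simp: invertible_incidence_jacobi_perron)
  have E: "E1_star (subst_prod (map jacobi_perron (p # ps))) F =
      E1_star (subst_prod (map jacobi_perron ps)) (E1_star (jacobi_perron p) F)"
    using E1_star_subst_comp[OF invertible_incidence_jacobi_perron inv] by simp
  show ?case
  proof (cases "ps = []")
    case True
    then show ?thesis using link unfolding E by (simp add: E1_star_id p)
  next
    case False
    have "linked (jp_patterns (fst (last ps) = snd (last ps)))
      (E1_star (subst_prod (map jacobi_perron ps)) (E1_star (jacobi_perron p) F))"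
    proof (rule Cons.IH[OF _ _ False _ link])
      show "\<forall>k<length ps. fst (ps ! k) \<le> snd (ps ! k) \<and> snd (ps ! k) \<noteq> 0"
        using Cons.prems(1) by (metis Suc_less_eq length_Cons nth_Cons_Suc)
      show "\<forall>k. Suc k < length ps \<longrightarrow> fst (ps ! k) = snd (ps ! k) \<longrightarrow> fst (ps ! Suc k) \<noteq> 0"
        using Cons.prems(2) by (metis Suc_less_eq length_Cons nth_Cons_Suc)
      show "fst (hd ps) \<noteq> 0" if "a = b"
        using Cons.prems(2)[rule_format, of 0] False that by (simp add: p hd_conv_nth)
    qed
    then show ?thesis unfolding E using False by simp
  qed
qed simp

text \<open>The fractal starts from the three unit faces, each subtile from one face, which is
  trivially linked.\<close>

lemma connected_rauzy_of_linked:
  assumes contr: "\<exists>\<kappa> l. contracting_incidence \<sigma> \<kappa> l"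
    and L: "finite L" "\<And>Q. Q \<in> L \<Longrightarrow> finite Q"
    and step: "\<And>F. linked L F \<Longrightarrow> linked L (E1_star \<sigma> F)"
    and U: "linked L {(0, 1), (0, 2), (0, 3)}"
  shows "connected (rauzy_fractal \<sigma>) \<and> connected (rauzy_subtile \<sigma> i)"
proof -
  obtain \<kappa> l where "contracting_incidence \<sigma> \<kappa> l" using contr by blast
  note limit = contracting_incidence.connected_hausdorff_limit_rauzy_approx[OF this]
  have iter: "linked L ((E1_star \<sigma> ^^ n) F)" if "linked L F" for n F
    by (induction n) (simp_all add: that step)
  have "connected (hausdorff_limit (rauzy_approx \<sigma> F))" if "finite F" "F \<noteq> {}" "linked L F" for F
    by (rule limit[OF that(1,2) L iter[OF that(3)]])
  from this[of "{(0, 1), (0, 2), (0, 3)}"] this[of "{(0, i)}"] show ?thesis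
    unfolding rauzy_fractal_def rauzy_subtile_def unit_faces_def using U by simp
qed

lemma linked_patterns_admissible:
  assumes "(\<exists>ks. admissible_brun ks \<and> \<sigma> = subst_prod (map brun ks)) \<or>
           (\<exists>ps. admissible_jacobi_perron ps \<and> \<sigma> = subst_prod (map jacobi_perron ps))"
  obtains L where "finite L" "\<And>Q. Q \<in> L \<Longrightarrow> finite Q" "linked L {(0, 1), (0, 2), (0, 3)}"
    "\<And>F. linked L F \<Longrightarrow> linked L (E1_star \<sigma> F)"
  using assms
proof (elim disjE exE conjE)
  fix ks assume "\<sigma> = subst_prod (map brun ks)"
  then have "linked brun_patterns (E1_star \<sigma> F)" if "linked brun_patterns F" for F
    using linked_E1_star_brun_prod[OF that] by simp
  moreover have "linked brun_patterns {(0, 1), (0, 2), (0, 3)}"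
    using linked_pattern[of "{(0, 1), (0, 2), (0, 3)}" brun_patterns 0] by (simp add: brun_patterns_def)
  moreover have "finite Q" if "Q \<in> brun_patterns" for Q
    using that by (auto simp: brun_patterns_def)
  ultimately show thesis by (intro that[of brun_patterns]) (simp_all add: brun_patterns_def)
next
  fix ps assume ps: "admissible_jacobi_perron ps" and \<sigma>: "\<sigma> = subst_prod (map jacobi_perron ps)"
  \<comment> \<open>Under iteration the set that enters the product has just left its last factor,
    so the flag of that factor is the one preserved by \<sigma>.\<close>
  define c where "c \<longleftrightarrow> fst (last ps) = snd (last ps)"
  have ne: "ps \<noteq> []" using ps by (simp add: admissible_jacobi_perron_def)
  have adm: "\<And>k. k < length ps \<Longrightarrow> fst (ps ! k) \<le> snd (ps ! k) \<and> snd (ps ! k) \<noteq> 0 \<and>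
      (fst (ps ! k) = snd (ps ! k) \<longrightarrow> fst (ps ! (Suc k mod length ps)) \<noteq> 0)"
    using ps by (simp add: admissible_jacobi_perron_def)
  have "fst (hd ps) \<noteq> 0" if c
    \<comment> \<open>At the last index the successor modulo the length is 0: this is the convention
      that the parameter after the last is the first.\<close>
    using adm[of "length ps - 1"] ne that by (simp add: c_def last_conv_nth hd_conv_nth)
  moreover have "fst (ps ! Suc k) \<noteq> 0" if "Suc k < length ps" "fst (ps ! k) = snd (ps ! k)" for k
    using adm[of k] that by simp
  ultimately have step: "linked (jp_patterns c) (E1_star \<sigma> F)" if "linked (jp_patterns c) F" for F
    unfolding \<sigma> c_def using adm ne that by (intro linked_E1_star_jacobi_perron_prod[of _ c]) (auto simp: c_def)
  have "linked (jp_patterns c) {(0, 1), (0, 3)}" "linked (jp_patterns c) {(0, 2), (0, 3)}"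
    using linked_pattern[of "{(0, 1), (0, 3)}" "jp_patterns c" 0] linked_pattern[of "{(0, 2), (0, 3)}" "jp_patterns c" 0]
    by (simp_all add: jp_patterns_def)
  then have "linked (jp_patterns c) ({(0, 1), (0, 3)} \<union> {(0, 2), (0, 3)})"
    by (rule linked_Un_overlap[of _ _ _ "(0, 3)"]) simp_all
  then have U: "linked (jp_patterns c) {(0, 1), (0, 2), (0, 3)}"
    by (simp add: insert_commute)
  show thesis by (rule that[OF _ _ U step]) (auto simp: jp_patterns_def split: if_splits)
qed

theorem corollary5p6:
  fixes \<sigma> :: subst
  assumes "(\<exists>ks. admissible_brun ks \<and> \<sigma> = subst_prod (map brun ks)) \<or>
           (\<exists>ps. admissible_jacobi_perron ps \<and> \<sigma> = subst_prod (map jacobi_perron ps))"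
  shows "connected (rauzy_fractal \<sigma>) \<and>
         connected (rauzy_subtile \<sigma> 1) \<and>
         connected (rauzy_subtile \<sigma> 2) \<and>
         connected (rauzy_subtile \<sigma> 3)"
proof -
  obtain L where L: "finite L" "\<And>Q. Q \<in> L \<Longrightarrow> finite Q" "linked L {(0, 1), (0, 2), (0, 3)}"
    "\<And>F. linked L F \<Longrightarrow> linked L (E1_star \<sigma> F)"
    by (rule linked_patterns_admissible[OF assms]) blast
  have "connected (rauzy_fractal \<sigma>) \<and> connected (rauzy_subtile \<sigma> i)" for i
    by (rule connected_rauzy_of_linked[OF contracting_incidence_admissible[OF assms] L(1,2,4,3)])
  then show ?thesis by blast
qed

end
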